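(* Let $G$ be a finite simple connected graph with diameter $D$. Then the following statements are equivalent: (a) $G$ is distance-regular. (b) $G$ is $D$-cospectral. (c) $G$ is $D$-isospectral.
   Context: $\partial(u,v)$ denotes the distance between vertices $u,v$, and $\operatorname{sp}$ denotes the spectrum (eigenvalues with multiplicities) of the adjacency matrix of a graph or pseudograph (a graph possibly with loops and multiple edges). Let $A=(a_{xy})$ be the adjacency matrix of $G$. Distance-regular has its standard meaning: for all $i,j,k$, the number of vertices at distance $i$ from $u$ and at distance $j$ from $v$ depends only on $i,j$ and $k=\partial(u,v)$. For $0\le h\le D$: - $G$ is $h$-punctually cospectral if $\operatorname{sp}(G-u-v)=\operatorname{sp}(G-w-z)$ for all pairs of vertices $u,v$ and $w,z$ with $\partial(u,v)=\partial(w,z)=h$, where $G-u-v$ is obtained from $G$ by removing the vertices in $\{u,v\}$ and all incident edges (for $h=0$ this is $G-u$). - For $h\ge 1$, $G$ is $h$-punctually isospectral if, for all pairs of vertices $u,v$ and $w,z$ with $\partial(u,v)=\partial(w,z)=h$, at least one of the following holds: $\operatorname{sp}(G\pm uv)=\operatorname{sp}(G\pm wz)$; $\operatorname{sp} G_{u+v}=\operatorname{sp} G_{w+z}$; $\operatorname{sp}(G+u\bar u v)=\operatorname{sp}(G+w\bar w z)$. For $h=0$, flipping $uu$ means adding a loop at $u$, and $G$ is $0$-punctually isospectral if $\operatorname{sp}(G+uu)=\operatorname{sp}(G+ww)$ for all vertices $u,w$, where $G+uu$ has adjacency matrix $A$ with the $uu$-entry changed to $1$. Here, for distinct $u,v$: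 $G\pm uv$ is obtained from $G$ by flipping $uv$ (deleting the edge $uv$ if present, adding it otherwise); $G_{u+v}$ is the pseudograph obtained by amalgamating $u$ and $v$ into one new vertex $u+v$ (adjacencies among other vertices are unchanged, the adjacency-matrix entry for $u+v$ and another vertex $x$ is $a_{ux}+a_{vx}$, and the diagonal entry at $u+v$ is $a_{uv}$); $G+u\bar u v$ is obtained by adding a new vertex $\bar u$ adjacent exactly to $u$ and $v$. $G$ is $D$-cospectral (respectively $D$-isospectral) if it is $i$-punctually cospectral (respectively $i$-punctually isospectral) for every $0\le i\le D$. *)

theory Defs
  imports
    "Graph_Theory.Shortest_Path"
    "Graph_Theory.Pair_Digraph"
    "Graph_Theory.Digraph_Component"
    "Jordan_Normal_Form.Char_Poly"
begin

section \<open>Distances in a graph\<close>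

text \<open>
  A finite simple graph is a \<open>pair_graph\<close>: a finite, loopless, symmetric digraph without
  parallel arcs.
\<close>

definition graph_dist :: "'a pair_pre_digraph \<Rightarrow> 'a \<Rightarrow> 'a \<Rightarrow> nat" where
  "graph_dist G u v = (LEAST n. \<exists>p. pre_digraph.awalk (with_proj G) u p v \<and> length p = n)"

lemma (in pair_wf_digraph) graph_dist_eq_mu:
  assumes "u \<rightarrow>\<^sup>*\<^bsub>with_proj G\<^esub> v"
  shows "\<mu> (\<lambda>_. 1) u v = ereal (graph_dist G u v)"
proof -
  have cost: "awalk_cost (\<lambda>_. 1) p = length p" for p :: "('a \<times> 'a) awalk"
    by (induction p) auto
  have "\<exists>n p. awalk u p v \<and> length p = n"
    using assms reachable_awalk by auto
  then have "\<exists>p. awalk u p v \<and> length p = graph_dist G u v"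
    unfolding graph_dist_def by (rule LeastI_ex)
  moreover have "graph_dist G u v \<le> length p" if "awalk u p v" for p
    unfolding graph_dist_def using that by (auto intro: Least_le)
  ultimately show ?thesis
    unfolding \<mu>_def cost by (intro antisym INF_greatest) (auto intro: INF_lower2)
qed

definition graph_diameter :: "'a pair_pre_digraph \<Rightarrow> nat" where
  "graph_diameter G = Max {graph_dist G u v | u v. u \<in> pverts G \<and> v \<in> pverts G}"

definition distance_regular :: "'a pair_pre_digraph \<Rightarrow> bool" where
  "distance_regular G \<longleftrightarrow>
    (\<exists>p :: nat \<Rightarrow> nat \<Rightarrow> nat \<Rightarrow> nat. \<forall>i j k. \<forall>u\<in>pverts G. \<forall>v\<in>pverts G.
      graph_dist G u v = k \<longrightarrow>
      card {x \<in> pverts G. graph_dist G u x = i \<and> graph_dist G v x = j} = p i j k)"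

section \<open>Pseudographs and their spectra\<close>

text \<open>
  \<open>mult H x y\<close> is the \<open>(x, y)\<close>-entry of the adjacency matrix of \<open>H\<close>. It is only relevant for
  \<open>x\<close> and \<open>y\<close> in \<open>vertices H\<close>. The arc-based multigraphs of the session \<open>Graph_Theory\<close> are not
  used here, because there a single loop may be one arc or a symmetric pair of arcs.
\<close>

record 'a pseudograph =
  vertices :: "'a set"
  mult :: "'a \<Rightarrow> 'a \<Rightarrow> nat"

definition adj_mat :: "'a list \<Rightarrow> 'a pseudograph \<Rightarrow> complex mat" where
  "adj_mat xs H = mat (length xs) (length xs) (\<lambda>(i, j). of_nat (mult H (xs ! i) (xs ! j)))"

text \<open>
  The roots of the characteristic polynomial are the eigenvalues with their algebraic
  multiplicities. All adjacency matrices considered here are real symmetric, so that all complex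
  eigenvalues are real and the algebraic multiplicities are the dimensions of the eigenspaces.
  The choice of the enumeration \<open>xs\<close> of the vertices is immaterial by \<open>sp_eq\<close> below.
\<close>

definition sp :: "'a pseudograph \<Rightarrow> complex multiset" where
  "sp H = proots (char_poly (adj_mat (SOME xs. distinct xs \<and> set xs = vertices H) H))"

lemma char_poly_permute:
  fixes f :: "nat \<Rightarrow> nat \<Rightarrow> complex"
  assumes p: "p permutes {0..<n}"
  shows "char_poly (mat n n (\<lambda>(i, j). f (p i) (p j))) = char_poly (mat n n (\<lambda>(i, j). f i j))"
proof -
  define M where "M = char_poly_matrix (mat n n (\<lambda>(i, j). f i j))"
  define N where "N = mat n n (\<lambda>(i, j). M $$ (i, p j))"
  have M: "M \<in> carrier_mat n n" by (simp add: M_def char_poly_matrix_def)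
  have N: "N \<in> carrier_mat n n" by (simp add: N_def)
  have p_lt: "p i < n" if "i < n" for i using permutes_in_image[OF p, of i] that by simp
  have inj: "p i = p j \<longleftrightarrow> i = j" for i j using permutes_inj[OF p] by (auto dest: injD)
  have T: "transpose_mat N = mat n n (\<lambda>(i, j). transpose_mat M $$ (p i, j))"
    using M by (auto simp: N_def p_lt intro!: eq_matI)
  have "det N = signof p * det M"
    using det_permute_rows[of "transpose_mat M" n p] det_transpose[OF M] det_transpose[OF N] p M T
    by simp
  moreover have "char_poly_matrix (mat n n (\<lambda>(i, j). f (p i) (p j))) = mat n n (\<lambda>(i, j). N $$ (p i, j))"
    by (auto simp: char_poly_matrix_def M_def N_def p_lt inj intro!: eq_matI)
  then have "char_poly (mat n n (\<lambda>(i, j). f (p i) (p j))) = signof p * det N"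
    unfolding char_poly_def using det_permute_rows[OF N p] by simp
  ultimately show ?thesis
    by (simp add: char_poly_def M_def sign_def)
qed

lemma sp_eq:
  assumes "distinct xs" "set xs = vertices H"
  shows "sp H = proots (char_poly (adj_mat xs H))"
proof -
  define ys where "ys = (SOME ys. distinct ys \<and> set ys = vertices H)"
  have ys: "distinct ys" "set ys = vertices H"
    using someI[of "\<lambda>ys. distinct ys \<and> set ys = vertices H" xs] assms by (auto simp: ys_def)
  then have "mset xs = mset ys"
    using assms set_eq_iff_mset_eq_distinct by blast
  then obtain p where p: "p permutes {..<length xs}" "permute_list p xs = ys"
    by (metis mset_eq_permutation)
  then have "adj_mat ys H = mat (length xs) (length xs) (\<lambda>(i, j). of_nat (mult H (xs ! p i) (xs ! p j)))"
    by (auto simp: adj_mat_def permute_list_nth intro!: eq_matI)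
  with char_poly_permute[of p "length xs" "\<lambda>i j. of_nat (mult H (xs ! i) (xs ! j))"] p
  have "char_poly (adj_mat ys H) = char_poly (adj_mat xs H)"
    by (simp add: adj_mat_def lessThan_atLeast0)
  then show ?thesis by (simp add: sp_def ys_def)
qed

section \<open>Perturbations of a graph\<close>

definition pseudograph_of :: "'a pair_pre_digraph \<Rightarrow> 'a pseudograph" where
  "pseudograph_of G =
    \<lparr>vertices = pverts G, mult = (\<lambda>x y. if (x, y) \<in> parcs G then 1 else 0)\<rparr>"

definition delete_vertices :: "'a pseudograph \<Rightarrow> 'a \<Rightarrow> 'a \<Rightarrow> 'a pseudograph" where
  "delete_vertices H u v = \<lparr>vertices = vertices H - {u, v}, mult = mult H\<rparr>"

text \<open>
  For \<open>u = v\<close> and a loopless \<open>H\<close> this adds a loop at \<open>u\<close>.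
\<close>

definition flip :: "'a pseudograph \<Rightarrow> 'a \<Rightarrow> 'a \<Rightarrow> 'a pseudograph" where
  "flip H u v =
    \<lparr>vertices = vertices H,
     mult = (\<lambda>x y. if {x, y} = {u, v} then (if mult H x y = 0 then 1 else 0) else mult H x y)\<rparr>"

text \<open>
  In the following two constructions \<open>None\<close> is the new vertex. The loop multiplicity of the
  amalgamated vertex is the multiplicity of \<open>uv\<close>, not twice that number.
\<close>

definition amalgamate :: "'a pseudograph \<Rightarrow> 'a \<Rightarrow> 'a \<Rightarrow> 'a option pseudograph" where
  "amalgamate H u v =
    \<lparr>vertices = insert None (Some ` (vertices H - {u, v})),
     mult = (\<lambda>x y. case (x, y) of
         (None, None) \<Rightarrow> mult H u v
       | (None, Some y') \<Rightarrow> mult H u y' + mult H v y'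
       | (Some x', None) \<Rightarrow> mult H x' u + mult H x' v
       | (Some x', Some y') \<Rightarrow> mult H x' y')\<rparr>"

definition add_common_neighbour :: "'a pseudograph \<Rightarrow> 'a \<Rightarrow> 'a \<Rightarrow> 'a option pseudograph" where
  "add_common_neighbour H u v =
    \<lparr>vertices = insert None (Some ` vertices H),
     mult = (\<lambda>x y. case (x, y) of
         (None, None) \<Rightarrow> 0
       | (None, Some y') \<Rightarrow> if y' \<in> {u, v} then 1 else 0
       | (Some x', None) \<Rightarrow> if x' \<in> {u, v} then 1 else 0
       | (Some x', Some y') \<Rightarrow> mult H x' y')\<rparr>"

section \<open>Punctual cospectrality and isospectrality\<close>

definition punctually_cospectral :: "nat \<Rightarrow> 'a pair_pre_digraph \<Rightarrow> bool" where
  "punctually_cospectral h G \<longleftrightarrow>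
    (\<forall>u\<in>pverts G. \<forall>v\<in>pverts G. \<forall>w\<in>pverts G. \<forall>z\<in>pverts G.
      graph_dist G u v = h \<and> graph_dist G w z = h \<longrightarrow>
      sp (delete_vertices (pseudograph_of G) u v) = sp (delete_vertices (pseudograph_of G) w z))"

definition punctually_isospectral :: "nat \<Rightarrow> 'a pair_pre_digraph \<Rightarrow> bool" where
  "punctually_isospectral h G \<longleftrightarrow>
    (if h = 0 then
       (\<forall>u\<in>pverts G. \<forall>w\<in>pverts G.
         sp (flip (pseudograph_of G) u u) = sp (flip (pseudograph_of G) w w))
     else
       (\<forall>u\<in>pverts G. \<forall>v\<in>pverts G. \<forall>w\<in>pverts G. \<forall>z\<in>pverts G.
         graph_dist G u v = h \<and> graph_dist G w z = h \<longrightarrow>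
           sp (flip (pseudograph_of G) u v) = sp (flip (pseudograph_of G) w z) \<or>
           sp (amalgamate (pseudograph_of G) u v) = sp (amalgamate (pseudograph_of G) w z) \<or>
           sp (add_common_neighbour (pseudograph_of G) u v) =
             sp (add_common_neighbour (pseudograph_of G) w z)))"

definition D_cospectral :: "nat \<Rightarrow> 'a pair_pre_digraph \<Rightarrow> bool" where
  "D_cospectral D G \<longleftrightarrow> (\<forall>i\<le>D. punctually_cospectral i G)"

definition D_isospectral :: "nat \<Rightarrow> 'a pair_pre_digraph \<Rightarrow> bool" where
  "D_isospectral D G \<longleftrightarrow> (\<forall>i\<le>D. punctually_isospectral i G)"

end

theory Submission
  imports Defs
begin

text \<open>
  For real \<open>x > 2 |V|\<close> let \<open>R = (x I - A)\<^sup>-\<^sup>1 = (\<Sum>l. A\<^sup>l / x\<^bsup>l+1\<^esup>)\<close> and let \<open>\<Phi>\<close> be the characteristic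
  polynomial of \<open>A\<close> at \<open>x\<close>. The characteristic polynomials of the perturbed graphs at \<open>x\<close> are
  \<^item> \<open>\<Phi> R\<^sub>u\<^sub>u\<close> for \<open>G - u\<close> and \<open>\<Phi> (1 - R\<^sub>u\<^sub>u)\<close> for \<open>G + uu\<close>,
  \<^item> \<open>\<Phi> (R\<^sub>u\<^sub>u R\<^sub>v\<^sub>v - R\<^sub>u\<^sub>v\<^sup>2)\<close> for \<open>G - u - v\<close>,
  \<^item> \<open>\<Phi> ((1 - e R\<^sub>u\<^sub>v)\<^sup>2 - R\<^sub>u\<^sub>u R\<^sub>v\<^sub>v)\<close> with \<open>e = 1 - 2 a\<^sub>u\<^sub>v\<close> for the flip of \<open>uv\<close>,
  \<^item> \<open>\<Phi> (x - R\<^sub>u\<^sub>u - R\<^sub>v\<^sub>v - 2 R\<^sub>u\<^sub>v)\<close> for the new common neighbour,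
  \<^item> \<open>\<Phi> (2 - (x - a\<^sub>u\<^sub>v) (r + R\<^sub>u\<^sub>v)) (r - R\<^sub>u\<^sub>v)\<close> for the amalgamation, if \<open>R\<^sub>u\<^sub>u = R\<^sub>v\<^sub>v = r\<close>.

  Since \<open>R\<^sub>u\<^sub>v \<ge> 0\<close> and \<open>x R\<^sub>u\<^sub>v < 1\<close> for \<open>u \<noteq> v\<close>, each of them determines \<open>R\<^sub>u\<^sub>v\<close> once the diagonal of \<open>R\<close> is
  constant, which is what the case of distance \<open>0\<close> says. So cospectrality and isospectrality both
  mean that the entries of \<open>R\<close>, or equivalently those of every \<open>A\<^sup>l\<close>, only depend on the distance.
  This is distance-regularity: the distance matrices are then polynomials in \<open>A\<close>, so that their
  products are again combinations of distance matrices.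
\<close>

section \<open>Determinants indexed by lists\<close>

text \<open>Indexing rows and columns by the entries of a list makes a block decomposition an append
  of lists, and a change of the vertex type a \<open>map\<close>.\<close>

definition det_on :: "'a list \<Rightarrow> ('a \<Rightarrow> 'a \<Rightarrow> 'b :: comm_ring_1) \<Rightarrow> 'b" where
  "det_on xs f = det (mat (length xs) (length xs) (\<lambda>(i, j). f (xs ! i) (xs ! j)))"

lemma det_on_cong:
  assumes "\<And>a b. a \<in> set xs \<Longrightarrow> b \<in> set xs \<Longrightarrow> f a b = g a b"
  shows "det_on xs f = det_on xs g"
  unfolding det_on_def using assms by (intro arg_cong[where f = det] eq_matI) auto

lemma det_on_map: "det_on (map h xs) f = det_on xs (\<lambda>a b. f (h a) (h b))"
  unfolding det_on_def by (intro arg_cong[where f = det] eq_matI) auto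

lemma det_on_mult:
  assumes "distinct xs"
  shows "det_on xs f * det_on xs g = det_on xs (\<lambda>a b. \<Sum>c\<in>set xs. f a c * g c b)"
proof -
  let ?n = "length xs"
  let ?M = "\<lambda>f. mat ?n ?n (\<lambda>(i, j). f (xs ! i) (xs ! j))"
  have "?M f * ?M g = ?M (\<lambda>a b. \<Sum>c\<in>set xs. f a c * g c b)"
    using sum.reindex_bij_betw[OF bij_betw_nth[OF assms refl refl]]
    by (auto simp: scalar_prod_def lessThan_atLeast0 intro!: eq_matI)
  then show ?thesis
    unfolding det_on_def using det_mult[of "?M f" ?n "?M g"] by simp
qed

lemma det_on_one:
  assumes "distinct xs"
  shows "det_on xs (\<lambda>a b. if a = b then 1 else 0) = (1 :: 'b :: comm_ring_1)"
proof -
  have "mat (length xs) (length xs) (\<lambda>(i, j). if xs ! i = xs ! j then 1 else 0) =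
      (1\<^sub>m (length xs) :: 'b mat)"
    using assms by (auto simp: nth_eq_iff_index_eq intro!: eq_matI)
  then show ?thesis by (simp add: det_on_def)
qed

lemma det_on_append_block:
  "mat (length (xs @ ys)) (length (xs @ ys)) (\<lambda>(i, j). f ((xs @ ys) ! i) ((xs @ ys) ! j)) =
   four_block_mat
     (mat (length xs) (length xs) (\<lambda>(i, j). f (xs ! i) (xs ! j)))
     (mat (length xs) (length ys) (\<lambda>(i, j). f (xs ! i) (ys ! j)))
     (mat (length ys) (length xs) (\<lambda>(i, j). f (ys ! i) (xs ! j)))
     (mat (length ys) (length ys) (\<lambda>(i, j). f (ys ! i) (ys ! j)))"
  by (rule eq_matI) (auto simp: nth_append)

lemma det_on_append_lower_zero:
  fixes f :: "'a \<Rightarrow> 'a \<Rightarrow> 'b :: idom"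
  assumes "\<And>a b. a \<in> set ys \<Longrightarrow> b \<in> set xs \<Longrightarrow> f a b = 0"
  shows "det_on (xs @ ys) f = det_on xs f * det_on ys f"
  unfolding det_on_def det_on_append_block using assms
  by (intro det_four_block_mat_lower_left_zero[where n = "length xs" and m = "length ys"])
     (auto intro!: eq_matI)

lemma det_on_append_upper_zero:
  fixes f :: "'a \<Rightarrow> 'a \<Rightarrow> 'b :: idom"
  assumes "\<And>a b. a \<in> set xs \<Longrightarrow> b \<in> set ys \<Longrightarrow> f a b = 0"
  shows "det_on (xs @ ys) f = det_on xs f * det_on ys f"
  unfolding det_on_def det_on_append_block using assms
  by (intro det_four_block_mat_upper_right_zero[where n = "length xs" and m = "length ys"])
     (auto intro!: eq_matI)

lemma det_on_single: "det_on [a] f = f a a"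
  unfolding det_on_def by (subst det_single) auto

lemma det_on_pair:
  fixes f :: "'a \<Rightarrow> 'a \<Rightarrow> 'b :: idom"
  shows "det_on [a, b] f = f a a * f b b - f a b * f b a"
proof -
  let ?c = "\<lambda>x. mat 1 1 (\<lambda>_. x) :: 'b mat"
  have "mat (length [a, b]) (length [a, b]) (\<lambda>(i, j). f ([a, b] ! i) ([a, b] ! j)) =
      four_block_mat (?c (f a a)) (?c (f a b)) (?c (f b a)) (?c (f b b))"
    by (rule eq_matI) (auto simp: less_Suc_eq)
  also have "det \<dots> = det (?c (f a a) * ?c (f b b) - ?c (f a b) * ?c (f b a))"
    by (rule det_four_block_mat[where n = 1]) (auto simp: scalar_prod_def mult.commute)
  also have "\<dots> = f a a * f b b - f a b * f b a"
    by (subst det_single) (auto simp: scalar_prod_def)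
  finally show ?thesis by (simp only: det_on_def)
qed

text \<open>Column \<open>k\<close> is replaced by the combination of all columns with coefficients
  \<open>t\<close> at \<open>k\<close> and \<open>y\<close> elsewhere. This multiplies the
  determinant by \<open>t\<close>, and by \<open>elim\<close> only the entry in row \<open>k\<close>
  of the new column survives. Keeping \<open>t\<close> avoids divisions: a new common neighbour uses
  \<open>t = 1\<close>, the amalgamation uses \<open>R_uu + R_uv\<close>.\<close>

lemma det_on_eliminate:
  fixes N :: "'a \<Rightarrow> 'a \<Rightarrow> 'b :: idom"
  assumes d: "distinct (k # ws)"
    and elim: "\<And>a. a \<in> set ws \<Longrightarrow> N a k * t + (\<Sum>c\<in>set ws. N a c * y c) = 0"
  shows "det_on (k # ws) N * t = (N k k * t + (\<Sum>c\<in>set ws. N k c * y c)) * det_on ws N"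
proof -
  define Q where "Q a b = (if b = k then if a = k then t else y a else if a = b then 1 else 0)" for a b
  have "det_on ([k] @ ws) Q = det_on [k] Q * det_on ws Q"
    using d by (intro det_on_append_upper_zero) (auto simp: Q_def)
  also have "det_on ws Q = det_on ws (\<lambda>a b. if a = b then 1 else 0)"
    using d by (intro det_on_cong) (auto simp: Q_def)
  also have "\<dots> = 1" using d by (intro det_on_one) auto
  also have "det_on [k] Q = t" by (simp add: det_on_single Q_def)
  finally have Q: "det_on (k # ws) Q = t" by simp
  let ?P = "\<lambda>a b. if b = k then N a k * t + (\<Sum>c\<in>set ws. N a c * y c) else N a b"
  have "det_on (k # ws) N * det_on (k # ws) Q = det_on (k # ws) (\<lambda>a b. \<Sum>c\<in>set (k # ws). N a c * Q c b)"
    by (rule det_on_mult[OF d])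
  also have "\<dots> = det_on ([k] @ ws) ?P"
  proof (simp only: append.simps, rule det_on_cong)
    fix a b assume b: "b \<in> set (k # ws)"
    have "(\<Sum>c\<in>set ws. N a c * Q c b) = (if b = k then \<Sum>c\<in>set ws. N a c * y c else N a b)"
    proof (cases "b = k")
      case True
      then show ?thesis using d by (auto simp: Q_def intro!: sum.cong)
    next
      case False
      then have "(\<Sum>c\<in>set ws. N a c * Q c b) = (\<Sum>c\<in>set ws. if c = b then N a c else 0)"
        by (intro sum.cong) (auto simp: Q_def)
      with False b show ?thesis by simp
    qed
    with b d show "(\<Sum>c\<in>set (k # ws). N a c * Q c b) = ?P a b"
      by (simp add: Q_def)
  qed
  also have "\<dots> = det_on [k] ?P * det_on ws ?P"
    using d elim by (intro det_on_append_lower_zero) auto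
  also have "det_on ws ?P = det_on ws N" using d by (intro det_on_cong) auto
  finally show ?thesis by (simp add: Q det_on_single)
qed

section \<open>Walks and the resolvent\<close>

text \<open>These are the entries of the matrix power \<open>A^l\<close>, with \<open>A\<close>
  restricted to \<open>V\<close>.\<close>

primrec walks :: "'a set \<Rightarrow> ('a \<Rightarrow> 'a \<Rightarrow> real) \<Rightarrow> nat \<Rightarrow> 'a \<Rightarrow> 'a \<Rightarrow> real" where
  "walks V A 0 u v = (if u = v then 1 else 0)"
| "walks V A (Suc l) u v = (\<Sum>w\<in>V. A u w * walks V A l w v)"

definition resolvent :: "'a set \<Rightarrow> ('a \<Rightarrow> 'a \<Rightarrow> real) \<Rightarrow> real \<Rightarrow> 'a \<Rightarrow> 'a \<Rightarrow> real" where
  "resolvent V A x u v = (\<Sum>l. walks V A l u v / x ^ Suc l)"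

locale weighted_graph =
  fixes V :: "'a set" and A :: "'a \<Rightarrow> 'a \<Rightarrow> real"
  assumes finite_V: "finite V"
    and A_sym: "A u v = A v u"
    and A_nonneg: "0 \<le> A u v"
    and A_le_1: "A u v \<le> 1"
begin

abbreviation W where "W \<equiv> walks V A"
abbreviation R where "R \<equiv> resolvent V A"

lemma walks_nonneg: "0 \<le> W l u v"
  by (induction l arbitrary: u) (auto intro!: sum_nonneg mult_nonneg_nonneg A_nonneg)

lemma walks_le: "W l u v \<le> card V ^ l"
proof (induction l arbitrary: u)
  case (Suc l)
  have "A u w * W l w v \<le> card V ^ l" for w
    using mult_mono[OF A_le_1[of u w] Suc.IH[of w]] walks_nonneg[of l w v] by simp
  then show ?case
    using sum_bounded_above[of V "\<lambda>w. A u w * W l w v" "card V ^ l"] by simp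
qed simp

lemma walks_add:
  assumes "u \<in> V"
  shows "W (l + m) u v = (\<Sum>w\<in>V. W l u w * W m w v)"
  using assms
proof (induction l arbitrary: u)
  case 0
  have "(\<Sum>w\<in>V. W 0 u w * W m w v) = (\<Sum>w\<in>V. if u = w then W m w v else 0)"
    by (intro sum.cong) auto
  with 0 finite_V show ?case by simp
next
  case (Suc l)
  have "W (Suc l + m) u v = (\<Sum>a\<in>V. \<Sum>w\<in>V. A u a * (W l a w * W m w v))"
    by (simp add: Suc.IH sum_distrib_left)
  also have "\<dots> = (\<Sum>w\<in>V. W (Suc l) u w * W m w v)"
    by (subst sum.swap) (simp add: sum_distrib_right mult.assoc)
  finally show ?case .
qed

lemma walks_sym:
  assumes "u \<in> V" "v \<in> V"
  shows "W l u v = W l v u"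
  using assms
proof (induction l arbitrary: u v)
  case (Suc l)
  have *: "W 1 w v = A w v" if "w \<in> V" for w
    using Suc.prems finite_V by (simp add: if_distrib cong: if_cong)
  \<comment> \<open>The recursion splits off the first step of a walk; here the last one is split
    off, so that reversing the remaining walk yields the recursion from \<open>v\<close>.\<close>
  have "W (l + 1) u v = (\<Sum>w\<in>V. W l u w * A w v)"
    unfolding walks_add[OF Suc.prems(1)] using * by (intro sum.cong) auto
  also have "\<dots> = (\<Sum>w\<in>V. A v w * W l w u)"
    using Suc by (intro sum.cong) (auto simp: A_sym mult.commute)
  finally show ?case by simp
qed auto

lemma walks_le_geometric:
  assumes "0 < (x :: real)"
  shows "W l u v / x ^ l \<le> (card V / x) ^ l"
  using walks_le[of l u v] assms by (simp add: power_divide divide_right_mono)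

lemma summable_geometric_card:
  assumes "real (card V) < x"
  shows "summable (\<lambda>l. (card V / x) ^ l)"
  using assms by (intro summable_geometric) auto

lemma summable_walks:
  assumes "real (card V) < x"
  shows "summable (\<lambda>l. W l u v / x ^ l)"
proof (rule summable_comparison_test'[OF summable_geometric_card[OF assms]])
  show "norm (W l u v / x ^ l) \<le> (card V / x) ^ l" for l
    using walks_le_geometric[of x l u v] walks_nonneg[of l u v] assms by simp
qed

lemma resolvent_sums:
  assumes "real (card V) < x"
  shows "(\<lambda>l. W l u v / x ^ Suc l) sums R x u v"
  using summable_divide[OF summable_walks[OF assms], of u v x] unfolding resolvent_def
  by (intro summable_sums) (simp add: field_simps)

lemma mult_resolvent_sums:
  assumes "real (card V) < x"
  shows "(\<lambda>l. W l u v / x ^ l) sums (x * R x u v)"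
proof -
  have "x \<noteq> 0" using assms by linarith
  with sums_mult[OF resolvent_sums[OF assms], of x u v] show ?thesis by simp
qed

lemma mult_resolvent_sums_Suc:
  assumes "real (card V) < x"
  shows "(\<lambda>l. W (Suc l) u v / x ^ Suc l) sums (x * R x u v - (if u = v then 1 else 0))"
  using mult_resolvent_sums[OF assms, of u v]
  by (subst sums_Suc_iff[where f = "\<lambda>l. W l u v / x ^ l"]) simp

lemma resolvent_sym: "u \<in> V \<Longrightarrow> v \<in> V \<Longrightarrow> R x u v = R x v u"
  unfolding resolvent_def by (simp add: walks_sym)

lemma resolvent_nonneg:
  assumes "real (card V) < x"
  shows "0 \<le> R x u v"
proof (rule sums_le[OF _ sums_zero resolvent_sums[OF assms]])
  show "0 \<le> W l u v / x ^ Suc l" for l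
    using walks_nonneg[of l u v] assms by simp
qed

text \<open>The walk of length 0 alone contributes \<open>1 / x\<close>, and no term is
  negative.\<close>

lemma resolvent_diag_pos:
  assumes "real (card V) < x"
  shows "0 < R x u u"
proof -
  have "0 < x" using assms by linarith
  have "(\<Sum>l\<in>{0}. W l u u / x ^ Suc l) \<le> R x u u"
    using walks_nonneg \<open>0 < x\<close>
    by (intro sum_le_suminf[OF sums_summable[OF resolvent_sums[OF assms]], folded resolvent_def])
       auto
  with \<open>0 < x\<close> show ?thesis by (auto intro: less_le_trans[rotated])
qed

text \<open>Multiplying the series by the matrix \<open>A\<close> shifts it by one power, so the
  result differs from \<open>x R\<close> only by the term of walk length 0.\<close>

lemma resolvent_eq:
  assumes "real (card V) < x"
  shows "x * R x u v - (\<Sum>w\<in>V. A u w * R x w v) = (if u = v then 1 else 0)"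
proof -
  have "(\<lambda>l. W (Suc l) u v / x ^ Suc l) sums (\<Sum>w\<in>V. A u w * R x w v)"
    using sums_sum[of V "\<lambda>w l. A u w * (W l w v / x ^ Suc l)", OF sums_mult[OF resolvent_sums[OF assms]]]
    by (simp add: sum_divide_distrib)
  from sums_unique2[OF this mult_resolvent_sums_Suc[OF assms]] show ?thesis by simp
qed

text \<open>
  Off the diagonal the series of the resolvent starts only with \<open>x\<^sup>-\<^sup>2\<close>.
\<close>

lemma resolvent_offdiag_less:
  assumes x: "2 * real (card V) < x" and "u \<noteq> v"
  shows "x * R x u v < 1"
proof -
  have pos: "real (card V) < x" "0 < x" using x by linarith+
  let ?q = "card V / x"
  have "(\<lambda>l. W (Suc l) u v / x ^ Suc l) sums (x * R x u v)"
    using mult_resolvent_sums_Suc[OF pos(1), of u v] \<open>u \<noteq> v\<close> by simp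
  moreover have "(\<lambda>l. ?q * ?q ^ l) sums (?q * (1 / (1 - ?q)))"
    using pos by (intro sums_mult geometric_sums) simp
  moreover have "W (Suc l) u v / x ^ Suc l \<le> ?q * ?q ^ l" for l
    using walks_le_geometric[OF pos(2), of "Suc l" u v] by simp
  ultimately have "x * R x u v \<le> ?q * (1 / (1 - ?q))"
    by (rule sums_le[rotated])
  also have "\<dots> < 1" using x pos by (simp add: field_simps)
  finally show ?thesis .
qed

text \<open>In \<open>y = 1 / x\<close> both resolvent entries are power series that agree for small
  positive \<open>y\<close>. Coefficients are compared by induction: once those below
  \<open>l\<close> agree, the difference is divided by \<open>y ^ l\<close>, and \<open>y\<close>
  tends to 0 from the right.\<close>

lemma walks_eq_iff_resolvent_eq:
  "(\<forall>l. W l u v = W l w z) \<longleftrightarrow> (\<forall>x > 2 * real (card V). R x u v = R x w z)"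
proof
  assume R: "\<forall>x > 2 * real (card V). R x u v = R x w z"
  show "\<forall>l. W l u v = W l w z"
  proof
    fix l show "W l u v = W l w z"
    proof (induction l rule: less_induct)
      case (less l)
      define a where "a k = W (k + l) u v - W (k + l) w z" for k
      \<comment> \<open>For \<open>0 < y < r\<close> the point \<open>1 / y\<close> exceeds
        \<open>2 card V\<close>, and \<open>card V * r < 1\<close> gives convergence. The summand 1
        keeps \<open>r\<close> well defined for empty \<open>V\<close>.\<close>
      define r :: real where "r = 1 / (2 * card V + 1)"
      have "r > 0" by (simp add: r_def add_nonneg_pos)
      have "(\<lambda>k. a k * y ^ k) sums 0" if y: "0 < y" "y < r" for y
      proof -
        have "inverse r < inverse y" using y by (intro less_imp_inverse_less) auto
        then have x: "2 * real (card V) < inverse y" by (simp add: r_def)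
        define b where "b k = W k u v - W k w z" for k
        have "real (card V) < inverse y" using x by linarith
        from sums_diff[OF mult_resolvent_sums[OF this, of u v] mult_resolvent_sums[OF this, of w z]]
        have "(\<lambda>k. b k * y ^ k) sums 0"
          using R x by (simp add: b_def power_inverse divide_inverse algebra_simps)
        moreover have "(\<Sum>k<l. b k * y ^ k) = 0"
          using less by (intro sum.neutral) (auto simp: b_def)
        ultimately have "(\<lambda>k. b (k + l) * y ^ (k + l)) sums 0"
          using sums_iff_shift[of "\<lambda>k. b k * y ^ k" l 0] by simp
        moreover have "inverse y ^ l * (b (k + l) * y ^ (k + l)) = a k * y ^ k" for k
          using y by (simp add: a_def b_def power_add power_inverse)
        ultimately show ?thesis
          using sums_mult[of "\<lambda>k. b (k + l) * y ^ (k + l)" 0 "inverse y ^ l"] by simp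
      qed
      define f where "f y = (\<Sum>k. a k * y ^ k)" for y
      have ab: "\<bar>a k\<bar> \<le> card V ^ (k + l)" for k
        using walks_le[of "k + l" u v] walks_le[of "k + l" w z]
          walks_nonneg[of "k + l" u v] walks_nonneg[of "k + l" w z]
        unfolding a_def by linarith
      have sm: "(\<lambda>k. a k * y ^ k) sums f y" if y: "norm y < r" for y
      proof -
        have "card V * \<bar>y\<bar> < 1"
        proof -
          have "card V * \<bar>y\<bar> \<le> card V * r" using y by (intro mult_left_mono) auto
          also have "\<dots> < 1" by (simp add: r_def field_simps add_nonneg_pos)
          finally show ?thesis .
        qed
        then have "summable (\<lambda>k. card V ^ l * (card V * \<bar>y\<bar>) ^ k)"
          by (intro summable_mult summable_geometric) auto
        then have "summable (\<lambda>k. a k * y ^ k)"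
        proof (rule summable_comparison_test')
          show "norm (a k * y ^ k) \<le> card V ^ l * (card V * \<bar>y\<bar>) ^ k" for k
            using mult_right_mono[OF ab, of "\<bar>y\<bar> ^ k" k]
            by (simp add: abs_mult power_abs power_add power_mult_distrib mult_ac)
        qed
        then show ?thesis unfolding f_def by (rule summable_sums)
      qed
      have "(f \<longlongrightarrow> a 0) (at 0)"
        using powser_limit_0[OF \<open>r > 0\<close> sm] by auto
      \<comment> \<open>The vanishing of \<open>f\<close> is only known for positive arguments, so
        the limit is restricted to the right.\<close>
      then have "(f \<longlongrightarrow> a 0) (at_right 0)"
        by (rule tendsto_within_subset) auto
      moreover have "eventually (\<lambda>y. f y = 0) (at_right 0)"
        using eventually_at_right_real[OF \<open>r > 0\<close>]
      proof eventually_elim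
        case (elim y)
        with \<open>\<And>y. 0 < y \<Longrightarrow> y < r \<Longrightarrow> (\<lambda>k. a k * y ^ k) sums 0\<close> show "f y = 0"
          unfolding f_def by (auto simp: sums_iff)
      qed
      then have "(f \<longlongrightarrow> 0) (at_right 0)" by (rule tendsto_eventually)
      ultimately have "a 0 = 0" by (rule tendsto_unique[OF trivial_limit_at_right_real])
      then show ?case by (simp add: a_def)
    qed
  qed
qed (simp add: resolvent_def)

end

section \<open>Characteristic polynomials of the perturbed graphs\<close>

definition char_val :: "'a pseudograph \<Rightarrow> real \<Rightarrow> complex" where
  "char_val H x = (\<Prod>z\<in>#sp H. of_real x - z)"

text \<open>The characteristic polynomial is monic and splits over the complex numbers, so it is the
  product of the linear factors of its roots. Any enumeration of the vertices is allowed because of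
  \<open>sp_eq\<close>.\<close>

lemma char_val_eq_det_on:
  assumes "distinct xs" "set xs = vertices H"
  shows "char_val H x = det_on xs (\<lambda>a b. (if a = b then of_real x else 0) - of_nat (mult H a b))"
proof -
  let ?A = "adj_mat xs H" and ?p = "char_poly (adj_mat xs H)"
  have A: "?A \<in> carrier_mat (length xs) (length xs)" by (simp add: adj_mat_def)
  have "?p = (\<Prod>z\<in>#sp H. [:- z, 1:])"
    using complex_poly_decompose_multiset[of ?p] degree_monic_char_poly[OF A]
    by (simp add: sp_eq[OF assms])
  then have "poly ?p (of_real x) = char_val H x"
    by (simp add: poly_prod_mset char_val_def)
  moreover have "- char_matrix ?A (of_real x) =
      mat (length xs) (length xs)
        (\<lambda>(i, j). (if xs ! i = xs ! j then of_real x else 0) - of_nat (mult H (xs ! i) (xs ! j)))"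
    using assms(1) by (auto simp: char_matrix_def adj_mat_def nth_eq_iff_index_eq intro!: eq_matI)
  ultimately show ?thesis
    unfolding det_on_def using char_poly_matrix[OF A, of "of_real x"] by simp
qed

section \<open>Recovering a spectrum from values of the characteristic polynomial\<close>

lemma proots_prod_linear_factors: "proots (\<Prod>z\<in>#m. [:- z, 1:]) = (m :: 'a :: idom multiset)"
proof (induction m)
  case (add z m)
  have "(\<Prod>z\<in>#m. [:- z, 1:]) \<noteq> (0 :: 'a poly)" by (auto simp: prod_mset_zero_iff)
  then have "proots ([:- z, 1:] * (\<Prod>z\<in>#m. [:- z, 1:])) = {#z#} + m"
    by (subst proots_mult) (auto simp: add.IH)
  then show ?case by simp
qed simp

text \<open>Polynomials that agree at infinitely many points are equal, and their roots with
  multiplicity give back the multisets. Hence testing beyond an arbitrary bound \<open>N\<close>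
  suffices.\<close>

lemma multiset_eq_iff_prod_eq:
  fixes m m' :: "complex multiset" and N :: real
  shows "m = m' \<longleftrightarrow> (\<forall>x>N. (\<Prod>z\<in>#m. of_real x - z) = (\<Prod>z\<in>#m'. of_real x - z))"
proof
  assume eq: "\<forall>x>N. (\<Prod>z\<in>#m. of_real x - z) = (\<Prod>z\<in>#m'. of_real x - z)"
  let ?p = "\<lambda>m. \<Prod>z\<in>#m. [:- z, 1 :: complex:]"
  have "of_real ` {N<..} \<subseteq> {z. poly (?p m - ?p m') z = 0}"
    using eq by (auto simp: poly_prod_mset)
  moreover have "infinite (complex_of_real ` {N<..})"
    by (simp add: finite_image_iff inj_on_def infinite_Ioi)
  ultimately have "?p m - ?p m' = 0"
    using poly_roots_finite finite_subset by blast
  then show "m = m'"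
    using proots_prod_linear_factors by (metis eq_iff_diff_eq_0)
qed simp

lemma sp_eq_iff_char_val_eq: "sp H = sp H' \<longleftrightarrow> (\<forall>x>N. char_val H x = char_val H' x)"
  unfolding char_val_def by (rule multiset_eq_iff_prod_eq)

section \<open>The matrix \<open>x I - A\<close> of a simple graph, its inverse and its
  minors\<close>

locale simple_pseudograph =
  fixes H :: "'a pseudograph"
  assumes finite_vertices: "finite (vertices H)"
    and mult_sym: "mult H u v = mult H v u"
    and mult_le_1: "mult H u v \<le> 1"
    and mult_diag: "mult H u u = 0"
begin

sublocale weighted_graph "vertices H" "\<lambda>u v. real (mult H u v)"
  using finite_vertices mult_sym mult_le_1 by unfold_locales auto

abbreviation V where "V \<equiv> vertices H"

abbreviation \<Phi> where "\<Phi> \<equiv> char_val H"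

definition M :: "real \<Rightarrow> 'a \<Rightarrow> 'a \<Rightarrow> complex" where
  "M x a b = (if a = b then of_real x else 0) - of_nat (mult H a b)"

lemma M_sym: "M x a b = M x b a"
  by (simp add: M_def mult_sym)

lemma \<Phi>_eq_det_on:
  assumes "distinct xs" "set xs = V"
  shows "\<Phi> x = det_on xs (M x)"
  unfolding char_val_eq_det_on[OF assms] M_def ..

lemma M_mult_R:
  assumes "real (card V) < x" "a \<in> V"
  shows "(\<Sum>c\<in>V. M x a c * of_real (R x c b)) = (if a = b then 1 else 0)"
proof -
  have "(\<Sum>c\<in>V. M x a c * of_real (R x c b)) =
      (\<Sum>c\<in>V. (if a = c then of_real (x * R x c b) else 0) - of_real (mult H a c * R x c b))"
    by (intro sum.cong) (auto simp: M_def algebra_simps)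
  also have "\<dots> = of_real (x * R x a b - (\<Sum>c\<in>V. mult H a c * R x c b))"
    using assms(2) finite_vertices by (simp add: sum_subtractf)
  finally show ?thesis by (simp add: resolvent_eq[OF assms(1)])
qed

lemma R_mult_M:
  assumes "real (card V) < x" "a \<in> V" "b \<in> V"
  shows "(\<Sum>c\<in>V. of_real (R x a c) * M x c b) = (if a = b then 1 else 0)"
proof -
  have "(\<Sum>c\<in>V. of_real (R x a c) * M x c b) = (\<Sum>c\<in>V. M x b c * of_real (R x c a))"
    using assms by (intro sum.cong) (auto simp: M_sym[of x b] resolvent_sym[of a])
  with M_mult_R[OF assms(1,3), of a] show ?thesis by auto
qed

text \<open>
  Jacobi's identity for complementary minors: multiply \<open>M\<close> by the identity matrix whose \<open>ks\<close>-columns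
  are replaced by those of \<open>R\<close>.
\<close>

lemma det_on_complementary_minor:
  assumes x: "real (card V) < x" and d: "distinct (ks @ ws)" and V: "set (ks @ ws) = V"
  shows "det_on ws (M x) = \<Phi> x * det_on ks (\<lambda>a b. of_real (R x a b))"
proof -
  define Q :: "'a \<Rightarrow> 'a \<Rightarrow> complex" where
    "Q a b = (if b \<in> set ks then of_real (R x a b) else if a = b then 1 else 0)" for a b
  have disj: "a \<notin> set ws" if "a \<in> set ks" for a using d that by auto
  have Q: "det_on (ks @ ws) Q = det_on ks (\<lambda>a b. of_real (R x a b))"
  proof -
    have "det_on (ks @ ws) Q = det_on ks Q * det_on ws Q"
      using disj by (intro det_on_append_upper_zero) (auto simp: Q_def)
    also have "det_on ks Q = det_on ks (\<lambda>a b. of_real (R x a b))"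
      by (intro det_on_cong) (auto simp: Q_def)
    also have "det_on ws Q = det_on ws (\<lambda>a b. if a = b then 1 else 0)"
      using disj by (intro det_on_cong) (auto simp: Q_def)
    also have "\<dots> = 1" using d by (intro det_on_one) auto
    finally show ?thesis by simp
  qed
  have "\<Phi> x * det_on (ks @ ws) Q = det_on (ks @ ws) (\<lambda>a b. \<Sum>c\<in>V. M x a c * Q c b)"
    unfolding \<Phi>_eq_det_on[OF d V] det_on_mult[OF d] V ..
  also have "\<dots> = det_on (ks @ ws) (\<lambda>a b. if b \<in> set ks then (if a = b then 1 else 0) else M x a b)"
  proof (rule det_on_cong)
    fix a b assume ab: "a \<in> set (ks @ ws)" "b \<in> set (ks @ ws)"
    show "(\<Sum>c\<in>V. M x a c * Q c b) = (if b \<in> set ks then (if a = b then 1 else 0) else M x a b)"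
    proof (cases "b \<in> set ks")
      case True
      have "a \<in> V" using ab V by blast
      from M_mult_R[OF x this, of b] True show ?thesis by (simp add: Q_def)
    next
      case False
      have "b \<in> V" using ab V by blast
      have "(\<Sum>c\<in>V. M x a c * Q c b) = (\<Sum>c\<in>V. if c = b then M x a c else 0)"
        using False by (intro sum.cong) (auto simp: Q_def)
      also have "\<dots> = M x a b"
        using \<open>b \<in> V\<close> finite_vertices by simp
      finally show ?thesis using False by simp
    qed
  qed
  also have "\<dots> = det_on ks (\<lambda>a b. if a = b then 1 else 0) * det_on ws (M x)"
    using disj by (subst det_on_append_lower_zero) (auto intro!: arg_cong2[where f = times] det_on_cong)
  also have "\<dots> = det_on ws (M x)" using d by (simp add: det_on_one)
  finally show ?thesis by (simp add: Q)
qed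

text \<open>With an empty complement Jacobi's identity says that 1 is \<Phi> times the determinant
  of the whole resolvent.\<close>

lemma \<Phi>_nonzero:
  assumes "real (card V) < x"
  shows "\<Phi> x \<noteq> 0"
proof -
  obtain xs where "distinct xs" "set xs = V"
    using finite_distinct_list[OF finite_vertices] by blast
  with det_on_complementary_minor[OF assms, of xs "[]"] show ?thesis
    by (auto simp: det_on_def)
qed

text \<open>Since \<open>R M = I\<close>, the perturbed matrix factors as
  \<open>M - J = (I - J R) M\<close>. The rows of \<open>I - J R\<close> outside \<open>ks\<close>
  are those of the identity, so its determinant reduces to the \<open>ks\<close>-block.\<close>

lemma \<Phi>_perturb:
  assumes x: "real (card V) < x" and d: "distinct (ks @ ws)" and V: "set (ks @ ws) = V"
    and J: "\<And>a b. a \<notin> set ks \<or> b \<notin> set ks \<Longrightarrow> J a b = 0"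
  shows "det_on (ks @ ws) (\<lambda>a b. M x a b - J a b) =
    \<Phi> x * det_on ks (\<lambda>a b. (if a = b then 1 else 0) - (\<Sum>c\<in>set ks. J a c * of_real (R x c b)))"
proof -
  let ?Q = "\<lambda>a b. (if a = b then 1 else 0) - (\<Sum>c\<in>set ks. J a c * of_real (R x c b))"
  have ks: "set ks \<subseteq> V" using V by auto
  have J_ws: "J a b = 0" if "a \<in> set ws" for a b
    using d that by (intro J) auto
  have "det_on (ks @ ws) ?Q = det_on ks ?Q * det_on ws ?Q"
    using d by (intro det_on_append_lower_zero) (auto simp: J_ws)
  also have "det_on ws ?Q = det_on ws (\<lambda>a b. if a = b then 1 else 0)"
    by (intro det_on_cong) (simp add: J_ws)
  also have "\<dots> = 1" using d by (intro det_on_one) auto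
  finally have Q: "det_on (ks @ ws) ?Q = det_on ks ?Q" by simp
  have "det_on (ks @ ws) ?Q * \<Phi> x = det_on (ks @ ws) (\<lambda>a b. \<Sum>c\<in>V. ?Q a c * M x c b)"
    unfolding \<Phi>_eq_det_on[OF d V] det_on_mult[OF d] V ..
  also have "\<dots> = det_on (ks @ ws) (\<lambda>a b. M x a b - J a b)"
  proof (rule det_on_cong)
    fix a b assume "a \<in> set (ks @ ws)" "b \<in> set (ks @ ws)"
    then have ab: "a \<in> V" "b \<in> V" using V by blast+
    have "(\<Sum>c\<in>V. (\<Sum>c'\<in>set ks. J a c' * of_real (R x c' c)) * M x c b) =
        (\<Sum>c'\<in>set ks. J a c' * (\<Sum>c\<in>V. of_real (R x c' c) * M x c b))"
      unfolding sum_distrib_right sum_distrib_left by (subst sum.swap) (simp add: mult.assoc)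
    also have "\<dots> = (\<Sum>c'\<in>set ks. if c' = b then J a b else 0)"
    proof (rule sum.cong[OF refl])
      fix c' assume "c' \<in> set ks"
      then have "c' \<in> V" using ks by blast
      from R_mult_M[OF x this ab(2)]
      show "J a c' * (\<Sum>c\<in>V. of_real (R x c' c) * M x c b) = (if c' = b then J a b else 0)"
        by simp
    qed
    also have "\<dots> = J a b" using J[of a b] by (auto simp: sum.delta)
    finally have "(\<Sum>c\<in>V. (\<Sum>c'\<in>set ks. J a c' * of_real (R x c' c)) * M x c b) = J a b" .
    moreover have "(\<Sum>c\<in>V. (if a = c then 1 else 0) * M x c b) = M x a b"
      using ab finite_vertices by (simp add: if_distrib[of "\<lambda>t. t * _"] cong: if_cong)
    ultimately show "(\<Sum>c\<in>V. ?Q a c * M x c b) = M x a b - J a b"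
      unfolding left_diff_distrib sum_subtractf by simp
  qed
  finally show ?thesis by (simp add: Q mult.commute)
qed

lemma obtain_complement_list:
  assumes "distinct ks" "set ks \<subseteq> V"
  obtains ws where "distinct (ks @ ws)" "set (ks @ ws) = V" "set ws = V - set ks"
proof -
  obtain ws where "distinct ws" "set ws = V - set ks"
    using finite_distinct_list[of "V - set ks"] finite_vertices by auto
  with assms show thesis by (intro that[of ws]) auto
qed

section \<open>Characteristic polynomials after deletion, flipping, a new neighbour and
  amalgamation\<close>

lemma char_val_delete_vertices:
  assumes "set ws = V - {u, v}" "distinct ws"
  shows "char_val (delete_vertices H u v) x = det_on ws (M x)"
  using char_val_eq_det_on[of ws "delete_vertices H u v" x] assms
  by (simp add: delete_vertices_def M_def[abs_def])

lemma char_val_delete_vertex: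
  assumes x: "real (card V) < x" and u: "u \<in> V"
  shows "char_val (delete_vertices H u u) x = \<Phi> x * of_real (R x u u)"
proof -
  obtain ws where ws: "distinct ([u] @ ws)" "set ([u] @ ws) = V" "set ws = V - set [u]"
    by (rule obtain_complement_list[of "[u]"]) (use u in auto)
  with det_on_complementary_minor[OF x ws(1,2)] show ?thesis
    by (subst char_val_delete_vertices[of ws]) (auto simp: det_on_single)
qed

lemma char_val_delete_two_vertices:
  assumes x: "real (card V) < x" and uv: "u \<in> V" "v \<in> V" "u \<noteq> v"
  shows "char_val (delete_vertices H u v) x =
    \<Phi> x * of_real (R x u u * R x v v - (R x u v)\<^sup>2)"
proof -
  have sym: "R x v u = R x u v" by (rule resolvent_sym[OF uv(2,1)])
  obtain ws where ws: "distinct ([u, v] @ ws)" "set ([u, v] @ ws) = V" "set ws = V - set [u, v]"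
    by (rule obtain_complement_list[of "[u, v]"]) (use uv in auto)
  then have "char_val (delete_vertices H u v) x = det_on ws (M x)"
    by (intro char_val_delete_vertices) auto
  also have "\<dots> = \<Phi> x * of_real (R x u u * R x v v - R x u v * R x v u)"
    unfolding det_on_complementary_minor[OF x ws(1,2)] by (simp add: det_on_pair)
  finally show ?thesis by (simp add: sym power2_eq_square)
qed

lemma char_val_add_loop:
  assumes x: "real (card V) < x" and u: "u \<in> V"
  shows "char_val (flip H u u) x = \<Phi> x * of_real (1 - R x u u)"
proof -
  obtain ws where ws: "distinct ([u] @ ws)" "set ([u] @ ws) = V" "set ws = V - set [u]"
    by (rule obtain_complement_list[of "[u]"]) (use u in auto)
  define J :: "'a \<Rightarrow> 'a \<Rightarrow> complex" where "J a b = (if a = u \<and> b = u then 1 else 0)" for a b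
  have "char_val (flip H u u) x = det_on ([u] @ ws) (\<lambda>a b. M x a b - J a b)"
    using ws by (subst char_val_eq_det_on[OF ws(1)])
      (auto simp: flip_def M_def J_def mult_diag intro!: det_on_cong)
  also have "\<dots> = \<Phi> x * of_real (1 - R x u u)"
    by (subst \<Phi>_perturb[OF x ws(1,2)]) (auto simp: J_def det_on_single)
  finally show ?thesis .
qed

lemma char_val_flip:
  assumes x: "real (card V) < x" and uv: "u \<in> V" "v \<in> V" "u \<noteq> v"
  shows "char_val (flip H u v) x =
    \<Phi> x * of_real ((1 - (1 - 2 * real (mult H u v)) * R x u v)\<^sup>2 - R x u u * R x v v)"
proof -
  have sym: "R x v u = R x u v" by (rule resolvent_sym[OF uv(2,1)])
  obtain ws where ws: "distinct ([u, v] @ ws)" "set ([u, v] @ ws) = V" "set ws = V - set [u, v]"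
    by (rule obtain_complement_list[of "[u, v]"]) (use uv in auto)
  \<comment> \<open>The flip adds \<open>e\<close> to the entries \<open>uv\<close> and
    \<open>vu\<close>: 1 for a missing edge, -1 for a present one.\<close>
  define e :: real where "e = 1 - 2 * real (mult H u v)"
  have m: "mult H u v = 0 \<or> mult H u v = 1" "mult H v u = mult H u v"
    using mult_le_1[of u v] mult_sym[of u v] by linarith+
  then have e: "e * e = 1" by (auto simp: e_def)
  define J :: "'a \<Rightarrow> 'a \<Rightarrow> complex" where "J a b = (if {a, b} = {u, v} then of_real e else 0)" for a b
  have J: "J u u = 0" "J v v = 0" "J u v = of_real e" "J v u = of_real e"
    using uv(3) by (auto simp: J_def doubleton_eq_iff)
  have "char_val (flip H u v) x = det_on ([u, v] @ ws) (\<lambda>a b. M x a b - J a b)"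
  proof (subst char_val_eq_det_on[OF ws(1)])
    show "set ([u, v] @ ws) = vertices (flip H u v)" using ws(2) by (simp add: flip_def)
    have *: "of_nat (mult (flip H u v) a b) = of_nat (mult H a b) + J a b" for a b
    proof (cases "{a, b} = {u, v}")
      case True
      then have "mult H a b = mult H u v" using m(2) by (auto simp: doubleton_eq_iff)
      with True m(1) show ?thesis by (auto simp: flip_def J_def e_def)
    qed (simp add: flip_def J_def)
    show "det_on ([u, v] @ ws) (\<lambda>a b. (if a = b then of_real x else 0) - of_nat (mult (flip H u v) a b)) =
        det_on ([u, v] @ ws) (\<lambda>a b. M x a b - J a b)"
      unfolding * M_def by (simp add: diff_diff_eq)
  qed
  \<comment> \<open>The remaining 2 by 2 matrix has \<open>1 - e R_uv\<close> on the diagonal and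
    \<open>- e R_vv\<close>, \<open>- e R_uu\<close> off it.\<close>
  also have "\<dots> = \<Phi> x * of_real ((1 - e * R x u v) * (1 - e * R x u v) - (e * e) * R x u u * R x v v)"
  proof (subst \<Phi>_perturb[OF x ws(1,2)])
    show "J a b = 0" if "a \<notin> set [u, v] \<or> b \<notin> set [u, v]" for a b
      using that by (auto simp: J_def doubleton_eq_iff)
  qed (use uv in \<open>simp add: det_on_pair J sym algebra_simps\<close>)
  finally show ?thesis by (simp add: e power2_eq_square) (simp add: e_def)
qed

text \<open>The new vertex is eliminated. Its column on the old vertices is minus the indicator
  vector of \<open>{u, v}\<close>, and the vector \<open>y\<close>, the sum of columns
  \<open>u\<close> and \<open>v\<close> of \<open>R\<close>, is mapped by \<open>M\<close> to that
  indicator, so \<open>t = 1\<close> cancels the column. What remains in the corner is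
  \<open>x\<close> minus the sum of the four entries of \<open>R\<close> on
  \<open>{u, v}\<close>.\<close>

lemma char_val_add_common_neighbour:
  assumes x: "real (card V) < x" and uv: "u \<in> V" "v \<in> V" "u \<noteq> v"
  shows "char_val (add_common_neighbour H u v) x =
    \<Phi> x * of_real (x - R x u u - R x v v - 2 * R x u v)"
proof -
  have sym: "R x v u = R x u v" by (rule resolvent_sym[OF uv(2,1)])
  obtain vs where vs: "distinct vs" "set vs = V"
    using finite_distinct_list[OF finite_vertices] by blast
  let ?ws = "map Some vs"
  let ?N = "\<lambda>a b. (if a = b then of_real x else 0) - of_nat (mult (add_common_neighbour H u v) a b) :: complex"
  define y where "y a = complex_of_real (R x (the a) u + R x (the a) v)" for a
  have d: "distinct (None # ?ws)" using vs by (auto simp: distinct_map)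
  have sum_ws: "(\<Sum>c\<in>set ?ws. g c) = (\<Sum>c\<in>V. g (Some c))" for g :: "'a option \<Rightarrow> complex"
    unfolding set_map vs(2) by (subst sum.reindex) auto
  have N_Some: "?N (Some a) (Some b) = M x a b" for a b
    by (simp add: add_common_neighbour_def M_def)
  have N_None: "?N None (Some a) = - (if a = u then 1 else 0) - (if a = v then 1 else 0)"
    "?N (Some a) None = - (if a = u then 1 else 0) - (if a = v then 1 else 0)"
    "?N None None = of_real x" for a
    using uv(3) by (auto simp: add_common_neighbour_def)
  have elim: "?N a None * 1 + (\<Sum>c\<in>set ?ws. ?N a c * y c) = 0" if a_ws: "a \<in> set ?ws" for a
  proof -
    obtain a' where a: "a = Some a'" "a' \<in> V" using a_ws unfolding set_map vs(2) by blast
    show ?thesis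
      unfolding sum_ws a N_Some N_None y_def
      using M_mult_R[OF x a(2), of u] M_mult_R[OF x a(2), of v]
      by (simp add: distrib_left sum.distrib)
  qed
  have "char_val (add_common_neighbour H u v) x = det_on (None # ?ws) ?N * 1"
    using d vs by (subst char_val_eq_det_on[of "None # ?ws"]) (auto simp: add_common_neighbour_def)
  also have "\<dots> = (?N None None * 1 + (\<Sum>c\<in>set ?ws. ?N None c * y c)) * det_on ?ws ?N"
    by (rule det_on_eliminate[OF d elim])
  also have "det_on ?ws ?N = \<Phi> x"
    unfolding det_on_map N_Some \<Phi>_eq_det_on[OF vs] ..
  also have "?N None None * 1 + (\<Sum>c\<in>set ?ws. ?N None c * y c) =
      of_real (x - R x u u - R x v v - 2 * R x u v)"
    unfolding sum_ws N_None y_def using uv finite_vertices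
    by (simp add: sym left_diff_distrib sum_subtractf sum_negf if_distrib[of "\<lambda>t. t * _"] cong: if_cong)
  finally show ?thesis by (simp add: mult.commute)
qed

text \<open>The sum \<open>y\<close> of columns \<open>u\<close> and \<open>v\<close> of
  \<open>R\<close> takes the same value \<open>t\<close> at \<open>u\<close> and at \<open>v\<close>
  because the two diagonal entries agree. So it descends to a vector on the amalgamated graph, and
  this vector eliminates the new vertex. The minor on the other vertices contains the factor
  \<open>t\<close> as well, which then cancels.\<close>

lemma char_val_amalgamate:
  assumes x: "real (card V) < x" and uv: "u \<in> V" "v \<in> V" "u \<noteq> v"
    and diag: "R x v v = R x u u"
  shows "char_val (amalgamate H u v) x =
    \<Phi> x * of_real ((2 - (x - real (mult H u v)) * (R x u u + R x u v)) * (R x u u - R x u v))"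
proof -
  have sym: "R x v u = R x u v" by (rule resolvent_sym[OF uv(2,1)])
  obtain ws where ws: "distinct ([u, v] @ ws)" "set ([u, v] @ ws) = V" "set ws = V - set [u, v]"
    by (rule obtain_complement_list[of "[u, v]"]) (use uv in auto)
  let ?ws = "map Some ws"
  let ?N = "\<lambda>a b. (if a = b then of_real x else 0) - of_nat (mult (amalgamate H u v) a b) :: complex"
  define t where "t = R x u u + R x u v"
  define y where "y c = complex_of_real (R x c u + R x c v)" for c
  have y: "y u = of_real t" "y v = of_real t"
    by (simp_all add: y_def t_def diag sym)
  \<comment> \<open>This permits the final cancellation of \<open>t\<close>, which is positive as a
    sum of a positive diagonal entry and a nonnegative one.\<close>
  have t: "complex_of_real t \<noteq> 0"
    using add_pos_nonneg[OF resolvent_diag_pos[OF x, of u] resolvent_nonneg[OF x, of u v]]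
    unfolding t_def[symmetric] by (simp del: of_real_add)
  have d: "distinct (None # ?ws)" using ws by (auto simp: distinct_map)
  have sum_ws: "(\<Sum>c\<in>set ?ws. g c) = (\<Sum>c\<in>set ws. g (Some c))" for g :: "'a option \<Rightarrow> complex"
    unfolding set_map by (subst sum.reindex) auto
  have My: "(\<Sum>c\<in>set ws. M x a c * y c) =
      (if a = u then 1 else 0) + (if a = v then 1 else 0) - (M x a u + M x a v) * of_real t"
    if "a \<in> V" for a
  proof -
    have split: "(\<Sum>c\<in>set ([u, v] @ ws). g c) = g u + (g v + (\<Sum>c\<in>set ws. g c))"
      for g :: "'a \<Rightarrow> complex" using ws(1) by simp
    have "(\<Sum>c\<in>V. M x a c * y c) = (if a = u then 1 else 0) + (if a = v then 1 else 0)"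
      using M_mult_R[OF x that, of u] M_mult_R[OF x that, of v]
      by (simp add: y_def distrib_left sum.distrib)
    moreover have "(\<Sum>c\<in>V. M x a c * y c) =
        M x a u * y u + (M x a v * y v + (\<Sum>c\<in>set ws. M x a c * y c))"
      using split unfolding ws(2) .
    ultimately show ?thesis by (simp add: y algebra_simps)
  qed
  have N_Some: "?N (Some a) (Some b) = M x a b" for a b
    by (simp add: amalgamate_def M_def)
  have N_None: "?N None (Some a) = M x u a + M x v a" "?N (Some a) None = M x a u + M x a v"
    if "a \<in> set ws" for a
    using that ws by (auto simp: amalgamate_def M_def)
  have N_None_None: "?N None None = of_real (x - mult H u v)"
    by (simp add: amalgamate_def)
  have elim: "?N a None * of_real t + (\<Sum>c\<in>set ?ws. ?N a c * y (the c)) = 0" if a_ws: "a \<in> set ?ws" for a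
  proof -
    obtain a' where a: "a = Some a'" "a' \<in> set ws" using a_ws by auto
    show ?thesis
      unfolding sum_ws a N_Some N_None[OF a(2)] option.sel
      by (subst My) (use ws a(2) in auto)
  qed
  \<comment> \<open>Rows \<open>u\<close> and \<open>v\<close> of \<open>M y\<close> add up to 2.
    Their part on \<open>{u, v}\<close> is \<open>2 (x - a_uv) t\<close>, whereas the new diagonal
    entry contributes only half of it.\<close>
  have row: "?N None None * of_real t + (\<Sum>c\<in>set ?ws. ?N None c * y (the c)) =
      of_real (2 - (x - real (mult H u v)) * t)"
  proof -
    have "(\<Sum>c\<in>set ?ws. ?N None c * y (the c)) =
        (\<Sum>c\<in>set ws. M x u c * y c) + (\<Sum>c\<in>set ws. M x v c * y c)"
      unfolding sum_ws sum.distrib[symmetric]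
      by (intro sum.cong refl) (simp only: N_None option.sel distrib_right)
    then show ?thesis
      unfolding N_None_None My[OF uv(1)] My[OF uv(2)] using uv(3)
      by (simp add: M_def mult_diag mult_sym[of v u] algebra_simps)
  qed
  have "char_val (amalgamate H u v) x * of_real t = det_on (None # ?ws) ?N * of_real t"
    using d ws by (subst char_val_eq_det_on[of "None # ?ws"]) (auto simp: amalgamate_def)
  also have "\<dots> =
      (?N None None * of_real t + (\<Sum>c\<in>set ?ws. ?N None c * y (the c))) * det_on ?ws ?N"
    by (rule det_on_eliminate[where y = "\<lambda>c. y (the c)", OF d elim])
  also note row
  also have "det_on ?ws ?N = det_on ws (M x)"
    unfolding det_on_map N_Some ..
  also have "\<dots> = \<Phi> x * of_real (R x u u * R x v v - R x u v * R x v u)"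
    unfolding det_on_complementary_minor[OF x ws(1,2)] by (simp add: det_on_pair)
  also have "R x u u * R x v v - R x u v * R x v u = (R x u u - R x u v) * t"
    by (simp add: t_def diag sym algebra_simps)
  finally show ?thesis using t by (simp add: t_def mult_ac)
qed

end

section \<open>Matrices that only depend on the distance\<close>

definition determined_by :: "'a set \<Rightarrow> ('a \<Rightarrow> 'a \<Rightarrow> 'b) \<Rightarrow> ('a \<Rightarrow> 'a \<Rightarrow> 'c) \<Rightarrow> bool" where
  "determined_by V d f \<longleftrightarrow>
    (\<forall>u\<in>V. \<forall>v\<in>V. \<forall>w\<in>V. \<forall>z\<in>V. d u v = d w z \<longrightarrow> f u v = f w z)"

lemma determined_byD:
  "\<lbrakk>determined_by V d f; u \<in> V; v \<in> V; w \<in> V; z \<in> V; d u v = d w z\<rbrakk> \<Longrightarrow> f u v = f w z"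
  unfolding determined_by_def by blast

lemma determined_byI:
  assumes "\<And>u v. u \<in> V \<Longrightarrow> v \<in> V \<Longrightarrow> f u v = \<phi> (d u v)"
  shows "determined_by V d f"
  using assms unfolding determined_by_def by simp

lemma determined_by_iff:
  "determined_by V d f \<longleftrightarrow> (\<exists>\<phi>. \<forall>u\<in>V. \<forall>v\<in>V. f u v = \<phi> (d u v))"
proof
  assume f: "determined_by V d f"
  \<comment> \<open>At values that \<open>d\<close> does not attain, the choice is
    arbitrary.\<close>
  define \<phi> where "\<phi> k = (SOME r. \<exists>u\<in>V. \<exists>v\<in>V. d u v = k \<and> r = f u v)" for k
  have "f u v = \<phi> (d u v)" if uv: "u \<in> V" "v \<in> V" for u v
  proof -
    from uv have "\<exists>r. \<exists>w\<in>V. \<exists>z\<in>V. d w z = d u v \<and> r = f w z" by blast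
    then have "\<exists>w\<in>V. \<exists>z\<in>V. d w z = d u v \<and> \<phi> (d u v) = f w z"
      unfolding \<phi>_def by (rule someI_ex)
    then obtain w z where "w \<in> V" "z \<in> V" "d w z = d u v" "\<phi> (d u v) = f w z" by blast
    with determined_byD[OF f uv, of w z] show ?thesis by simp
  qed
  then show "\<exists>\<phi>. \<forall>u\<in>V. \<forall>v\<in>V. f u v = \<phi> (d u v)" by blast
qed (auto simp: determined_by_def)

text \<open>The distance enters as the least exponent for which the power of \<open>A\<close> has a
  nonzero entry. That such an exponent exists for every pair encodes connectedness.\<close>

locale distance_graph = simple_pseudograph H for H :: "'a pseudograph" +
  fixes d :: "'a \<Rightarrow> 'a \<Rightarrow> nat"
  assumes walks_dist: "u \<in> V \<Longrightarrow> v \<in> V \<Longrightarrow> W (d u v) u v \<noteq> 0"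
    and walks_less_dist: "u \<in> V \<Longrightarrow> v \<in> V \<Longrightarrow> l < d u v \<Longrightarrow> W l u v = 0"
begin

lemma dist_sym:
  assumes "u \<in> V" "v \<in> V"
  shows "d u v = d v u"
proof (rule ccontr)
  assume "d u v \<noteq> d v u"
  then consider "d u v < d v u" | "d v u < d u v" by linarith
  then show False
  proof cases
    case 1
    from walks_less_dist[OF assms(2,1) 1] walks_dist[OF assms] show False
      by (simp add: walks_sym[OF assms])
  next
    case 2
    from walks_less_dist[OF assms 2] walks_dist[OF assms(2,1)] show False
      by (simp add: walks_sym[OF assms])
  qed
qed

lemma dist_eq_0_iff:
  assumes "u \<in> V" "v \<in> V"
  shows "d u v = 0 \<longleftrightarrow> u = v"
  using walks_dist[OF assms] walks_less_dist[OF assms, of 0]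
  by (cases "d u v = 0") (auto split: if_splits)

lemma dist_self: "u \<in> V \<Longrightarrow> d u u = 0"
  by (simp add: dist_eq_0_iff)

lemma eq_iff_eq_if_dist_eq:
  assumes "u \<in> V" "v \<in> V" "w \<in> V" "z \<in> V" "d u v = d w z"
  shows "u = v \<longleftrightarrow> w = z"
  using dist_eq_0_iff[OF assms(1,2)] dist_eq_0_iff[OF assms(3,4)] assms(5) by simp

lemma mult_eq_dist:
  assumes "u \<in> V" "v \<in> V"
  shows "mult H u v = (if d u v = 1 then 1 else 0)"
proof -
  have W1: "W 1 u v = mult H u v"
    using assms finite_vertices by (simp add: if_distrib cong: if_cong)
  show ?thesis
  proof (cases "d u v = 1")
    case True
    with walks_dist[OF assms] W1 mult_le_1[of u v] show ?thesis by simp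
  next
    case False
    then consider "d u v = 0" | "1 < d u v" by linarith
    then show ?thesis
    proof cases
      case 1
      then show ?thesis using dist_eq_0_iff[OF assms] mult_diag by simp
    next
      case 2
      then show ?thesis using walks_less_dist[OF assms 2] W1 by simp
    qed
  qed
qed

text \<open>
  The matrix of distance \<open>j\<close> is a linear combination of \<open>A\<^sup>j\<close>, where it has a nonzero coefficient,
  and of the matrices of smaller distances.
\<close>

lemma determined_by_mult_dist:
  assumes W: "\<And>l. determined_by V d (W l)"
    and X: "\<And>l. determined_by V d (\<lambda>u v. \<Sum>w\<in>V. X u w * W l w v)"
  shows "determined_by V d (\<lambda>u v. \<Sum>w\<in>V. X u w * of_bool (d w v = j))"
proof (induction j rule: less_induct)
  case (less j)
  show ?case
  proof (cases "\<exists>a\<in>V. \<exists>b\<in>V. d a b = j")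
    \<comment> \<open>If no pair has distance \<open>j\<close>, the coefficient \<open>c j\<close>
      below would be unspecified, but all the sums are 0.\<close>
    case False
    then have "(\<Sum>w\<in>V. X u w * of_bool (d w v = j)) = 0" if "v \<in> V" for u v
      using that by (intro sum.neutral) auto
    then show ?thesis by (intro determined_byI[where \<phi> = "\<lambda>_. 0"])
  next
    case True
    then obtain a b where ab: "a \<in> V" "b \<in> V" "d a b = j" by blast
    obtain c where c: "\<And>w v. w \<in> V \<Longrightarrow> v \<in> V \<Longrightarrow> W j w v = c (d w v)"
      using W[of j, unfolded determined_by_iff] by blast
    have "c j \<noteq> 0" using walks_dist[OF ab(1,2)] ab c by auto
    let ?S = "\<lambda>k u v. \<Sum>w\<in>V. X u w * of_bool (d w v = k)"
    have S: "?S j u v = ((\<Sum>w\<in>V. X u w * W j w v) - (\<Sum>k<j. c k * ?S k u v)) / c j"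
      if "v \<in> V" for u v
    proof -
      \<comment> \<open>Distances above \<open>j\<close> do not contribute, because there are no
        walks of length \<open>j\<close> between such vertices.\<close>
      have "W j w v = c j * of_bool (d w v = j) + (\<Sum>k<j. c k * of_bool (d w v = k))" if w: "w \<in> V" for w
      proof -
        have "(\<Sum>k<j. c k * of_bool (d w v = k)) = (\<Sum>k<j. if k = d w v then c k else 0)"
          by (intro sum.cong) auto
        also have "\<dots> = (if d w v < j then c (d w v) else 0)" by simp
        finally show ?thesis
          using c[OF w \<open>v \<in> V\<close>] walks_less_dist[OF w \<open>v \<in> V\<close>, of j] by auto
      qed
      then have "(\<Sum>w\<in>V. X u w * W j w v) =
          (\<Sum>w\<in>V. c j * (X u w * of_bool (d w v = j)) + (\<Sum>k<j. c k * (X u w * of_bool (d w v = k))))"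
        by (intro sum.cong refl) (simp only: distrib_left sum_distrib_left mult.left_commute)
      also have "\<dots> = c j * ?S j u v + (\<Sum>k<j. c k * ?S k u v)"
        by (simp only: sum.distrib sum_distrib_left sum.swap[of _ "{..<j}"])
      finally show ?thesis using \<open>c j \<noteq> 0\<close> by simp
    qed
    show ?thesis
      unfolding determined_by_def
    proof (intro ballI impI)
      fix u v w z assume uv: "u \<in> V" "v \<in> V" and wz: "w \<in> V" "z \<in> V" and eq: "d u v = d w z"
      have "?S k u v = ?S k w z" if "k < j" for k
        by (rule determined_byD[OF less[OF that] uv wz eq])
      moreover have "(\<Sum>a\<in>V. X u a * W j a v) = (\<Sum>a\<in>V. X w a * W j a z)"
        by (rule determined_byD[OF X uv wz eq])
      ultimately show "?S j u v = ?S j w z"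
        unfolding S[OF uv(2)] S[OF wz(2)] by simp
    qed
  qed
qed

text \<open>Powers of \<open>A\<close> are traded for distance matrices one factor at a time:
  \<open>A^l A^m = A^(l+m)\<close> yields the claim for \<open>A^l\<close> times a distance matrix,
  transposition moves the distance matrix to the left, and a second application replaces the
  remaining power.\<close>

lemma determined_by_dist_mult_dist:
  assumes W: "\<And>l. determined_by V d (W l)"
  shows "determined_by V d (\<lambda>u v. \<Sum>w\<in>V. of_bool (d u w = i) * of_bool (d w v = j) :: real)"
proof (rule determined_by_mult_dist[OF W])
  fix l
  have *: "determined_by V d (\<lambda>u v. \<Sum>w\<in>V. W l u w * of_bool (d w v = i))"
  proof (rule determined_by_mult_dist[OF W])
    fix m
    show "determined_by V d (\<lambda>u v. \<Sum>w\<in>V. W l u w * W m w v)"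
      unfolding determined_by_def
    proof (intro ballI impI)
      fix u v w z assume uv: "u \<in> V" "v \<in> V" and wz: "w \<in> V" "z \<in> V" and eq: "d u v = d w z"
      from determined_byD[OF W[of "l + m"] uv wz eq]
      show "(\<Sum>a\<in>V. W l u a * W m a v) = (\<Sum>a\<in>V. W l w a * W m a z)"
        unfolding walks_add[OF uv(1)] walks_add[OF wz(1)] .
    qed
  qed
  have sym: "(\<Sum>w\<in>V. of_bool (d u w = i) * W l w v) = (\<Sum>w\<in>V. W l v w * of_bool (d w u = i))"
    if "u \<in> V" "v \<in> V" for u v
  proof (rule sum.cong[OF refl])
    fix w assume "w \<in> V"
    show "of_bool (d u w = i) * W l w v = W l v w * of_bool (d w u = i)"
      unfolding dist_sym[OF that(1) \<open>w \<in> V\<close>] walks_sym[OF that(2) \<open>w \<in> V\<close>] by (rule mult.commute)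
  qed
  show "determined_by V d (\<lambda>u v. \<Sum>w\<in>V. of_bool (d u w = i) * W l w v)"
    unfolding determined_by_def
  proof (intro ballI impI)
    fix u v w z assume uv: "u \<in> V" "v \<in> V" and wz: "w \<in> V" "z \<in> V" and eq: "d u v = d w z"
    have "d v u = d z w" using eq dist_sym[OF uv] dist_sym[OF wz] by simp
    from determined_byD[OF * uv(2,1) wz(2,1) this]
    show "(\<Sum>a\<in>V. of_bool (d u a = i) * W l a v) = (\<Sum>a\<in>V. of_bool (d w a = i) * W l a z)"
      unfolding sym[OF uv] sym[OF wz] .
  qed
qed

text \<open>From right to left, intersection numbers are the entries of products of two distance
  matrices. From left to right, induction on \<open>l\<close> writes \<open>A^(l+1)\<close> as the
  distance-1 matrix times a matrix that is a function of the distance.\<close>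

lemma intersection_numbers_iff_walks:
  "(\<forall>i j. determined_by V d (\<lambda>u v. card {x \<in> V. d u x = i \<and> d v x = j})) \<longleftrightarrow>
    (\<forall>l. determined_by V d (W l))"
proof
  assume W: "\<forall>l. determined_by V d (W l)"
  have card: "real (card {x \<in> V. d u x = i \<and> d v x = j}) =
      (\<Sum>w\<in>V. of_bool (d u w = i) * of_bool (d w v = j))" if "v \<in> V" for u v i j
  proof -
    have "(\<Sum>w\<in>V. of_bool (d u w = i) * of_bool (d w v = j) :: real) =
        (\<Sum>w\<in>V. if d u w = i \<and> d v w = j then 1 else 0)"
    proof (rule sum.cong[OF refl])
      fix w assume "w \<in> V"
      show "of_bool (d u w = i) * of_bool (d w v = j) =
          (if d u w = i \<and> d v w = j then 1 else 0 :: real)"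
        unfolding dist_sym[OF that \<open>w \<in> V\<close>] by simp
    qed
    then show ?thesis
      using finite_vertices by (simp add: sum.If_cases Int_def)
  qed
  show "\<forall>i j. determined_by V d (\<lambda>u v. card {x \<in> V. d u x = i \<and> d v x = j})"
  proof (intro allI)
    fix i j
    have *: "determined_by V d (\<lambda>u v. \<Sum>w\<in>V. of_bool (d u w = i) * of_bool (d w v = j) :: real)"
      by (rule determined_by_dist_mult_dist) (use W in blast)
    show "determined_by V d (\<lambda>u v. card {x \<in> V. d u x = i \<and> d v x = j})"
      unfolding determined_by_def
    proof (intro ballI impI)
      fix u v w z assume uv: "u \<in> V" "v \<in> V" and wz: "w \<in> V" "z \<in> V" and eq: "d u v = d w z"
      from determined_byD[OF * uv wz eq]
      have "real (card {x \<in> V. d u x = i \<and> d v x = j}) = real (card {x \<in> V. d w x = i \<and> d z x = j})"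
        unfolding card[OF uv(2)] card[OF wz(2)] .
      then show "card {x \<in> V. d u x = i \<and> d v x = j} = card {x \<in> V. d w x = i \<and> d z x = j}"
        by simp
    qed
  qed
next
  assume I: "\<forall>i j. determined_by V d (\<lambda>u v. card {x \<in> V. d u x = i \<and> d v x = j})"
  define D where "D = (\<lambda>(x, y). d x y) ` (V \<times> V)"
  have "finite D" using finite_vertices by (simp add: D_def)
  \<comment> \<open>Grouping the vertices by their distances from \<open>u\<close> and
    \<open>v\<close> turns such a sum into a combination of intersection numbers.\<close>
  have product: "(\<Sum>x\<in>V. \<alpha> (d u x) * \<beta> (d v x)) =
      (\<Sum>q\<in>D \<times> D. card {x \<in> V. d u x = fst q \<and> d v x = snd q} * (\<alpha> (fst q) * \<beta> (snd q)))"
    if "u \<in> V" "v \<in> V" for u v and \<alpha> \<beta> :: "nat \<Rightarrow> real"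
  proof -
    have "(\<Sum>x\<in>V. \<alpha> (d u x) * \<beta> (d v x)) =
        (\<Sum>q\<in>D \<times> D. \<Sum>x\<in>{x \<in> V. (d u x, d v x) = q}. \<alpha> (d u x) * \<beta> (d v x))"
    proof (rule sum.group[symmetric])
      show "(\<lambda>x. (d u x, d v x)) ` V \<subseteq> D \<times> D" using that unfolding D_def by blast
    qed (use finite_vertices \<open>finite D\<close> in auto)
    also have "\<dots> = (\<Sum>q\<in>D \<times> D. \<Sum>x\<in>{x \<in> V. d u x = fst q \<and> d v x = snd q}. \<alpha> (fst q) * \<beta> (snd q))"
      by (intro sum.cong) auto
    finally show ?thesis by simp
  qed
  show "\<forall>l. determined_by V d (W l)"
  proof
    fix l show "determined_by V d (W l)"
    proof (induction l)
      case 0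
      show ?case
        by (rule determined_byI[where \<phi> = "\<lambda>k. if k = 0 then 1 else 0"]) (simp add: dist_eq_0_iff)
    next
      case (Suc l)
      obtain \<beta> where \<beta>: "\<And>w v. w \<in> V \<Longrightarrow> v \<in> V \<Longrightarrow> W l w v = \<beta> (d w v)"
        using Suc[unfolded determined_by_iff] by blast
      have W: "W (Suc l) u v = (\<Sum>x\<in>V. of_bool (d u x = 1) * \<beta> (d v x))"
        if "u \<in> V" "v \<in> V" for u v
        unfolding walks.simps
      proof (rule sum.cong[OF refl])
        fix x assume "x \<in> V"
        show "real (mult H u x) * W l x v = of_bool (d u x = 1) * \<beta> (d v x)"
          unfolding mult_eq_dist[OF that(1) \<open>x \<in> V\<close>] dist_sym[OF that(2) \<open>x \<in> V\<close>]
            \<beta>[OF \<open>x \<in> V\<close> that(2)] by simp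
      qed
      show ?case
        unfolding determined_by_def
      proof (intro ballI impI)
        fix u v w z assume uv: "u \<in> V" "v \<in> V" and wz: "w \<in> V" "z \<in> V" and eq: "d u v = d w z"
        have "card {x \<in> V. d u x = i \<and> d v x = j} = card {x \<in> V. d w x = i \<and> d z x = j}" for i j
          using I determined_byD[OF _ uv wz eq] by blast
        then show "W (Suc l) u v = W (Suc l) w z"
          unfolding W[OF uv] W[OF wz]
            product[OF uv, of "\<lambda>k. of_bool (k = 1)"] product[OF wz, of "\<lambda>k. of_bool (k = 1)"]
          by simp
      qed
    qed
  qed
qed

section \<open>Walks and spectra of perturbed graphs in terms of the resolvent\<close>

lemma walks_determined_iff_resolvent:
  "(\<forall>l. determined_by V d (W l)) \<longleftrightarrow> (\<forall>x > 2 * real (card V). determined_by V d (R x))"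
  using walks_eq_iff_resolvent_eq unfolding determined_by_def by metis

lemma card_less: "2 * real (card V) < x \<Longrightarrow> real (card V) < x"
  by linarith

lemma cospectral_iff_resolvent:
  "determined_by V d (\<lambda>u v. sp (delete_vertices H u v)) \<longleftrightarrow>
    (\<forall>x > 2 * real (card V). determined_by V d (R x))"
proof
  assume sp: "determined_by V d (\<lambda>u v. sp (delete_vertices H u v))"
  show "\<forall>x > 2 * real (card V). determined_by V d (R x)"
  proof (intro allI impI)
    fix x assume x2: "2 * real (card V) < x"
    note x = card_less[OF x2]
    have eq: "char_val (delete_vertices H u v) x = char_val (delete_vertices H w z) x"
      if "u \<in> V" "v \<in> V" "w \<in> V" "z \<in> V" "d u v = d w z" for u v w z
      using determined_byD[OF sp that] by (simp add: char_val_def)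
    \<comment> \<open>At distance 0 a single vertex is deleted, and \<Phi> can be cancelled.\<close>
    have diag: "R x u u = R x w w" if "u \<in> V" "w \<in> V" for u w
      using eq[of u u w w] that \<Phi>_nonzero[OF x]
      by (simp add: char_val_delete_vertex[OF x] dist_self)
    show "determined_by V d (R x)"
      unfolding determined_by_def
    proof (intro ballI impI)
      fix u v w z assume uv: "u \<in> V" "v \<in> V" and wz: "w \<in> V" "z \<in> V" and d: "d u v = d w z"
      show "R x u v = R x w z"
      proof (cases "u = v")
        case True
        then have "w = z" using eq_iff_eq_if_dist_eq[OF uv wz d] by simp
        with True diag[OF uv(1) wz(1)] show ?thesis by simp
      next
        case False
        then have "w \<noteq> z" using eq_iff_eq_if_dist_eq[OF uv wz d] by simp
        have "R x u u * R x v v - (R x u v)\<^sup>2 = R x w w * R x z z - (R x w z)\<^sup>2"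
          using eq[OF uv wz d] \<Phi>_nonzero[OF x]
          unfolding char_val_delete_two_vertices[OF x uv False]
            char_val_delete_two_vertices[OF x wz \<open>w \<noteq> z\<close>] mult_cancel_left of_real_eq_iff
          by blast
        then have "(R x u v)\<^sup>2 = (R x w z)\<^sup>2"
          using diag[OF uv(1) wz(1)] diag[OF uv(2) wz(2)] by simp
        then show ?thesis
          by (rule power2_eq_imp_eq[OF _ resolvent_nonneg[OF x] resolvent_nonneg[OF x]])
      qed
    qed
  qed
next
  assume R: "\<forall>x > 2 * real (card V). determined_by V d (R x)"
  show "determined_by V d (\<lambda>u v. sp (delete_vertices H u v))"
    unfolding determined_by_def
  proof (intro ballI impI)
    fix u v w z assume uv: "u \<in> V" "v \<in> V" and wz: "w \<in> V" "z \<in> V" and d: "d u v = d w z"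
    show "sp (delete_vertices H u v) = sp (delete_vertices H w z)"
      unfolding sp_eq_iff_char_val_eq[where N = "2 * real (card V)"]
    proof (intro allI impI)
      fix x assume x2: "2 * real (card V) < x"
      note x = card_less[OF x2]
      have diag: "R x a a = R x b b" if "a \<in> V" "b \<in> V" for a b
        using R x2 that determined_byD[of V d "R x" a a b b] by (simp add: dist_self)
      have R: "R x u v = R x w z"
        using R x2 determined_byD[OF _ uv wz d] by blast
      show "char_val (delete_vertices H u v) x = char_val (delete_vertices H w z) x"
      proof (cases "u = v")
        case True
        then have "w = z" using eq_iff_eq_if_dist_eq[OF uv wz d] by simp
        with True show ?thesis
          using R uv wz by (simp add: char_val_delete_vertex[OF x])
      next
        case False
        then have "w \<noteq> z" using eq_iff_eq_if_dist_eq[OF uv wz d] by simp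
        show ?thesis
          unfolding char_val_delete_two_vertices[OF x uv False]
            char_val_delete_two_vertices[OF x wz \<open>w \<noteq> z\<close>] R
            diag[OF uv(1) wz(1)] diag[OF uv(2) wz(2)] ..
      qed
    qed
  qed
qed

text \<open>After cancelling the diagonal, the squares of \<open>1 - e R_uv\<close> and
  \<open>1 - e R_wz\<close> agree. Both bases are positive, so they agree themselves.\<close>

lemma resolvent_eq_if_flip_eq:
  assumes x2: "2 * real (card V) < x" and uv: "u \<in> V" "v \<in> V" "u \<noteq> v"
    and wz: "w \<in> V" "z \<in> V" "w \<noteq> z" and m: "mult H u v = mult H w z"
    and diag: "R x u u * R x v v = R x w w * R x z z"
    and eq: "char_val (flip H u v) x = char_val (flip H w z) x"
  shows "R x u v = R x w z"
proof -
  note x = card_less[OF x2]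
  define e where "e = 1 - 2 * real (mult H w z)"
  have e: "e = 1 \<or> e = -1" using mult_le_1[of w z] by (auto simp: e_def le_Suc_eq)
  have pos: "0 < 1 - e * R x a b" if "a \<noteq> b" for a b
  proof (cases "card V = 0")
    case True
    with uv finite_vertices show ?thesis by simp
  next
    case False
    \<comment> \<open>With \<open>x \<ge> 1\<close> the bound \<open>x R < 1\<close> gives
      \<open>R < 1\<close>, which settles \<open>e = 1\<close>; for \<open>e = -1\<close>
      nonnegativity is enough.\<close>
    then have "1 \<le> x" using x2 by linarith
    then have "R x a b \<le> x * R x a b"
      using mult_right_mono[OF \<open>1 \<le> x\<close> resolvent_nonneg[OF x, of a b]] by simp
    then have "R x a b < 1" using resolvent_offdiag_less[OF x2 that] by linarith
    then show ?thesis using e resolvent_nonneg[OF x, of a b] by auto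
  qed
  have "(1 - e * R x u v)\<^sup>2 - R x u u * R x v v = (1 - e * R x w z)\<^sup>2 - R x w w * R x z z"
    using eq \<Phi>_nonzero[OF x]
    unfolding char_val_flip[OF x uv] char_val_flip[OF x wz] m e_def[symmetric]
      mult_cancel_left of_real_eq_iff
    by blast
  then have "(1 - e * R x u v)\<^sup>2 = (1 - e * R x w z)\<^sup>2" using diag by simp
  then have "1 - e * R x u v = 1 - e * R x w z"
    by (rule power2_eq_imp_eq[OF _ less_imp_le[OF pos[OF uv(3)]] less_imp_le[OF pos[OF wz(3)]]])
  then show ?thesis using e by auto
qed

text \<open>The difference of the two formulas factors as \<open>(s' - s) (2 - y s - y s')\<close>.
  The second factor is positive, since \<open>y \<le> x\<close> and both \<open>x s\<close> and
  \<open>x s'\<close> are below 1.\<close>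

lemma resolvent_eq_if_amalgamate_eq:
  assumes x2: "2 * real (card V) < x" and uv: "u \<in> V" "v \<in> V" "u \<noteq> v"
    and wz: "w \<in> V" "z \<in> V" "w \<noteq> z" and m: "mult H u v = mult H w z"
    and diag: "R x v v = R x u u" "R x z z = R x w w" "R x u u = R x w w"
    and eq: "char_val (amalgamate H u v) x = char_val (amalgamate H w z) x"
  shows "R x u v = R x w z"
proof -
  note x = card_less[OF x2]
  define r s s' y where "r = R x w w" and "s = R x u v" and "s' = R x w z"
    and "y = x - real (mult H w z)"
  have "(2 - y * (r + s)) * (r - s) = (2 - y * (r + s')) * (r - s')"
    using eq \<Phi>_nonzero[OF x]
    unfolding char_val_amalgamate[OF x uv diag(1)] char_val_amalgamate[OF x wz diag(2)] m diag(3)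
      mult_cancel_left of_real_eq_iff r_def s_def s'_def y_def
    by blast
  then have "(s' - s) * (2 - y * s - y * s') = 0" by (simp add: algebra_simps)
  moreover have "y * s \<le> x * s" "y * s' \<le> x * s'"
    using resolvent_nonneg[OF x] by (auto simp: y_def s_def s'_def intro!: mult_right_mono)
  then have "2 - y * s - y * s' > 0"
    using resolvent_offdiag_less[OF x2 uv(3)] resolvent_offdiag_less[OF x2 wz(3)]
    unfolding s_def s'_def by linarith
  ultimately show ?thesis by (simp add: s_def s'_def)
qed

lemma resolvent_eq_if_add_common_neighbour_eq:
  assumes x: "real (card V) < x" and uv: "u \<in> V" "v \<in> V" "u \<noteq> v"
    and wz: "w \<in> V" "z \<in> V" "w \<noteq> z"
    and diag: "R x u u + R x v v = R x w w + R x z z"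
    and eq: "char_val (add_common_neighbour H u v) x = char_val (add_common_neighbour H w z) x"
  shows "R x u v = R x w z"
proof -
  have "x - R x u u - R x v v - 2 * R x u v = x - R x w w - R x z z - 2 * R x w z"
    using eq \<Phi>_nonzero[OF x]
    unfolding char_val_add_common_neighbour[OF x uv] char_val_add_common_neighbour[OF x wz]
      mult_cancel_left of_real_eq_iff
    by blast
  with diag show ?thesis by linarith
qed

text \<open>Each of the three alternatives forces the same equality of resolvent entries, so
  different pairs may satisfy different ones. Conversely, the alternative of the flip always
  holds.\<close>

lemma isospectral_iff_resolvent:
  "(\<forall>u\<in>V. \<forall>v\<in>V. \<forall>w\<in>V. \<forall>z\<in>V. d u v = d w z \<longrightarrow>
      (if u = v then sp (flip H u u) = sp (flip H w w)
       else sp (flip H u v) = sp (flip H w z) \<or>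
         sp (amalgamate H u v) = sp (amalgamate H w z) \<or>
         sp (add_common_neighbour H u v) = sp (add_common_neighbour H w z))) \<longleftrightarrow>
    (\<forall>x > 2 * real (card V). determined_by V d (R x))"
  (is "?iso \<longleftrightarrow> _")
proof
  assume iso: ?iso
  show "\<forall>x > 2 * real (card V). determined_by V d (R x)"
  proof (intro allI impI)
    fix x assume x2: "2 * real (card V) < x"
    note x = card_less[OF x2]
    have diag: "R x u u = R x w w" if uw: "u \<in> V" "w \<in> V" for u w
    proof -
      have "d u u = d w w" using uw by (simp add: dist_self)
      from iso[rule_format, OF uw(1) uw(1) uw(2) uw(2) this]
      have "sp (flip H u u) = sp (flip H w w)" by simp
      then have "char_val (flip H u u) x = char_val (flip H w w) x" by (simp add: char_val_def)
      then have "1 - R x u u = 1 - R x w w"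
        using \<Phi>_nonzero[OF x]
        unfolding char_val_add_loop[OF x uw(1)] char_val_add_loop[OF x uw(2)]
          mult_cancel_left of_real_eq_iff by blast
      then show ?thesis by simp
    qed
    show "determined_by V d (R x)"
      unfolding determined_by_def
    proof (intro ballI impI)
      fix u v w z assume uv: "u \<in> V" "v \<in> V" and wz: "w \<in> V" "z \<in> V" and d: "d u v = d w z"
      have m: "mult H u v = mult H w z" using uv wz d by (simp add: mult_eq_dist)
      show "R x u v = R x w z"
      proof (cases "u = v")
        case True
        then have "w = z" using eq_iff_eq_if_dist_eq[OF uv wz d] by simp
        with True diag[OF uv(1) wz(1)] show ?thesis by simp
      next
        case False
        then have "w \<noteq> z" using eq_iff_eq_if_dist_eq[OF uv wz d] by simp
        from iso[rule_format, OF uv wz d] False consider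
            (flip) "sp (flip H u v) = sp (flip H w z)"
          | (amalgamate) "sp (amalgamate H u v) = sp (amalgamate H w z)"
          | (add) "sp (add_common_neighbour H u v) = sp (add_common_neighbour H w z)"
          by auto
        then show ?thesis
        proof cases
          case flip
          show ?thesis
            by (rule resolvent_eq_if_flip_eq[OF x2 uv False wz \<open>w \<noteq> z\<close> m])
              (simp_all add: char_val_def flip diag[OF uv(1) wz(1)] diag[OF uv(2) wz(2)])
        next
          case amalgamate
          show ?thesis
            by (rule resolvent_eq_if_amalgamate_eq[OF x2 uv False wz \<open>w \<noteq> z\<close> m])
              (simp_all add: char_val_def amalgamate diag[OF uv(2) uv(1)] diag[OF wz(2) wz(1)]
                diag[OF uv(1) wz(1)])
        next
          case add
          show ?thesis
            by (rule resolvent_eq_if_add_common_neighbour_eq[OF x uv False wz \<open>w \<noteq> z\<close>])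
              (simp_all add: char_val_def add diag[OF uv(1) wz(1)] diag[OF uv(2) wz(2)])
        qed
      qed
    qed
  qed
next
  assume R: "\<forall>x > 2 * real (card V). determined_by V d (R x)"
  show ?iso
  proof (intro ballI impI)
    fix u v w z assume uv: "u \<in> V" "v \<in> V" and wz: "w \<in> V" "z \<in> V" and d: "d u v = d w z"
    have m: "mult H u v = mult H w z" using uv wz d by (simp add: mult_eq_dist)
    \<comment> \<open>For \<open>u = v\<close> this is the statement about loops, so it serves both
      branches of the conditional.\<close>
    have "sp (flip H u v) = sp (flip H w z)"
      unfolding sp_eq_iff_char_val_eq[where N = "2 * real (card V)"]
    proof (intro allI impI)
      fix x assume x2: "2 * real (card V) < x"
      note x = card_less[OF x2]
      have diag: "R x a a = R x b b" if "a \<in> V" "b \<in> V" for a b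
        using R x2 that determined_byD[of V d "R x" a a b b] by (simp add: dist_self)
      have R: "R x u v = R x w z"
        using R x2 determined_byD[OF _ uv wz d] by blast
      show "char_val (flip H u v) x = char_val (flip H w z) x"
      proof (cases "u = v")
        case True
        then have "w = z" using eq_iff_eq_if_dist_eq[OF uv wz d] by simp
        with True show ?thesis
          using R uv wz by (simp add: char_val_add_loop[OF x])
      next
        case False
        then have "w \<noteq> z" using eq_iff_eq_if_dist_eq[OF uv wz d] by simp
        show ?thesis
          unfolding char_val_flip[OF x uv False] char_val_flip[OF x wz \<open>w \<noteq> z\<close>] R m
            diag[OF uv(1) wz(1)] diag[OF uv(2) wz(2)] ..
      qed
    qed
    moreover note eq_iff_eq_if_dist_eq[OF uv wz d]
    ultimately show "if u = v then sp (flip H u u) = sp (flip H w w)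
       else sp (flip H u v) = sp (flip H w z) \<or>
         sp (amalgamate H u v) = sp (amalgamate H w z) \<or>
         sp (add_common_neighbour H u v) = sp (add_common_neighbour H w z)"
      by auto
  qed
qed

end

section \<open>Walks and distances in a \<open>pair_graph\<close>\<close>

context pair_graph
begin

abbreviation adj :: "'a \<Rightarrow> 'a \<Rightarrow> real" where
  "adj u v \<equiv> real (mult (pseudograph_of G) u v)"

text \<open>A sum of nonnegative terms is nonzero exactly if some term is, so the recursion of
  \<open>walks\<close> unfolds like prepending an arc to a walk.\<close>

lemma walks_nonzero_iff_awalk:
  assumes "u \<in> pverts G"
  shows "walks (pverts G) adj n u v \<noteq> 0 \<longleftrightarrow> (\<exists>p. awalk u p v \<and> length p = n)"
  using assms
proof (induction n arbitrary: u)
  case 0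
  then show ?case by (auto simp: awalk_Nil_iff)
next
  case (Suc n)
  have nonneg: "0 \<le> walks (pverts G) adj n w v" for w
    by (induction n arbitrary: w) (auto intro!: sum_nonneg)
  have "walks (pverts G) adj (Suc n) u v \<noteq> 0 \<longleftrightarrow>
      (\<exists>w\<in>pverts G. adj u w * walks (pverts G) adj n w v \<noteq> 0)"
    using pair_finite_verts nonneg by (subst walks.simps, subst sum_nonneg_eq_0_iff) auto
  also have "\<dots> \<longleftrightarrow> (\<exists>w p. (u, w) \<in> parcs G \<and> awalk w p v \<and> length p = n)"
    using Suc.IH by (auto simp: pseudograph_of_def dest: in_arcsD2)
  also have "\<dots> \<longleftrightarrow> (\<exists>p. awalk u p v \<and> length p = Suc n)"
    unfolding length_Suc_conv
    by (auto simp: awalk_Cons_iff) (metis fst_conv snd_conv awalk_Cons_iff length_Cons)+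
  finally show ?case .
qed

text \<open>Connectedness and symmetry give a walk between any two vertices, so the minimum in
  \<open>graph_dist\<close> is attained; minimality excludes shorter walks.\<close>

lemma distance_graph_graph_dist:
  assumes "Digraph_Component.connected (with_proj G)"
  shows "distance_graph (pseudograph_of G) (graph_dist G)"
proof -
  have sym: "(u, v) \<in> parcs G \<longleftrightarrow> (v, u) \<in> parcs G" for u v
    using pair_sym_arcs by (auto simp: symmetric_def dest: symD)
  interpret simple_pseudograph "pseudograph_of G"
    using pair_finite_verts sym no_loops' by unfold_locales (auto simp: pseudograph_of_def)
  have walk: "\<exists>n p. awalk u p v \<and> length p = n" if "u \<in> pverts G" "v \<in> pverts G" for u v
  proof -
    have "u \<rightarrow>\<^sup>*\<^bsub>with_proj G\<^esub> v"
      using symmetric_connected_imp_strongly_connected[OF pair_sym_arcs assms] that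
      by (simp add: strongly_connected_def)
    then show ?thesis unfolding reachable_awalk by blast
  qed
  have V: "V = pverts G" by (simp add: pseudograph_of_def)
  show ?thesis
  proof unfold_locales
    fix u v assume "u \<in> V" "v \<in> V"
    then have uv: "u \<in> pverts G" "v \<in> pverts G" using V by simp_all
    have "\<exists>p. awalk u p v \<and> length p = graph_dist G u v"
      unfolding graph_dist_def using walk[OF uv] by (rule LeastI_ex)
    then show "W (graph_dist G u v) u v \<noteq> 0"
      unfolding V walks_nonzero_iff_awalk[OF uv(1)] .
    show "W l u v = 0" if "l < graph_dist G u v" for l
      using not_less_Least[OF that[unfolded graph_dist_def]] walks_nonzero_iff_awalk[OF uv(1), of l v]
      unfolding V by blast
  qed
qed

end

theorem theorem5p2:
  fixes G :: "'a pair_pre_digraph" and D :: nat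
  assumes "pair_graph G"
    and "Digraph_Component.connected (with_proj G)"
    and "graph_diameter G = D"
  shows "(distance_regular G \<longleftrightarrow> D_cospectral D G) \<and> (D_cospectral D G \<longleftrightarrow> D_isospectral D G)"
proof -
  interpret pair_graph G by (rule assms(1))
  define H d where "H = pseudograph_of G" and "d = graph_dist G"
  interpret distance_graph H d
    unfolding H_def d_def by (rule distance_graph_graph_dist[OF assms(2)])
  have V: "vertices H = pverts G" by (simp add: H_def pseudograph_of_def)
  \<comment> \<open>As the image of a finite set, the set of distances has a maximum that bounds
    them all; hence the conditions for \<open>i \<le> D\<close> cover every pair of
    vertices.\<close>
  have "{d u v | u v. u \<in> pverts G \<and> v \<in> pverts G} = (\<lambda>(u, v). d u v) ` (pverts G \<times> pverts G)"
    by auto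
  then have D: "d u v \<le> D" if "u \<in> pverts G" "v \<in> pverts G" for u v
    using that pair_finite_verts unfolding assms(3)[symmetric] graph_diameter_def d_def
    by (intro Max_ge) auto
  have "distance_regular G \<longleftrightarrow>
      (\<forall>i j. determined_by (pverts G) d (\<lambda>u v. card {x \<in> pverts G. d u x = i \<and> d v x = j}))"
    (is "_ \<longleftrightarrow> (\<forall>i j. ?I i j)")
  proof
    assume "distance_regular G"
    then obtain p where p: "\<And>i j u v. u \<in> pverts G \<Longrightarrow> v \<in> pverts G \<Longrightarrow>
        card {x \<in> pverts G. d u x = i \<and> d v x = j} = p i j (d u v)"
      unfolding distance_regular_def d_def by blast
    show "\<forall>i j. ?I i j"
    proof (intro allI)
      show "?I i j" for i j by (rule determined_byI[where \<phi> = "p i j"]) (rule p)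
    qed
  next
    assume "\<forall>i j. ?I i j"
    \<comment> \<open>Combining \<open>i\<close> and \<open>j\<close> into one pair \<open>q\<close>
      lets a single choice collect the functions into one \<open>p\<close>.\<close>
    have "\<exists>\<phi>. \<forall>u\<in>pverts G. \<forall>v\<in>pverts G.
        card {x \<in> pverts G. d u x = fst q \<and> d v x = snd q} = \<phi> (d u v)" for q
      using \<open>\<forall>i j. ?I i j\<close> unfolding determined_by_iff by blast
    then obtain p where p: "\<forall>q. \<forall>u\<in>pverts G. \<forall>v\<in>pverts G.
        card {x \<in> pverts G. d u x = fst q \<and> d v x = snd q} = p q (d u v)"
      using choice[of "\<lambda>q \<phi>. \<forall>u\<in>pverts G. \<forall>v\<in>pverts G.
        card {x \<in> pverts G. d u x = fst q \<and> d v x = snd q} = \<phi> (d u v)"] by blast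
    show "distance_regular G"
      unfolding distance_regular_def d_def[symmetric]
    proof (intro exI allI ballI impI)
      fix i j k u v
      assume "u \<in> pverts G" "v \<in> pverts G" "d u v = k"
      then show "card {x \<in> pverts G. d u x = i \<and> d v x = j} = (\<lambda>i j. p (i, j)) i j k"
        using p[rule_format, of u v "(i, j)"] by simp
    qed
  qed
  moreover have "D_cospectral D G \<longleftrightarrow> determined_by (pverts G) d (\<lambda>u v. sp (delete_vertices H u v))"
    (is "_ \<longleftrightarrow> ?cosp")
  proof
    assume cosp: "D_cospectral D G"
    show ?cosp
      unfolding determined_by_def
    proof (intro ballI impI)
      fix u v w z assume uv: "u \<in> pverts G" "v \<in> pverts G" and wz: "w \<in> pverts G" "z \<in> pverts G"
        and eq: "d u v = d w z"
      have "punctually_cospectral (d u v) G" using cosp D[OF uv] by (simp add: D_cospectral_def)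
      from this[unfolded punctually_cospectral_def, folded H_def d_def, rule_format,
          OF uv wz conjI[OF refl eq[symmetric]]]
      show "sp (delete_vertices H u v) = sp (delete_vertices H w z)" .
    qed
  next
    assume ?cosp
    have "sp (delete_vertices H u v) = sp (delete_vertices H w z)"
      if "u \<in> pverts G" "v \<in> pverts G" "w \<in> pverts G" "z \<in> pverts G" "d u v = i" "d w z = i"
      for u v w z i
      using determined_byD[OF \<open>?cosp\<close> that(1-4)] that(5,6) by simp
    then show "D_cospectral D G"
      unfolding D_cospectral_def punctually_cospectral_def H_def[symmetric] d_def[symmetric] by blast
  qed
  moreover have "D_isospectral D G \<longleftrightarrow>
    (\<forall>u\<in>pverts G. \<forall>v\<in>pverts G. \<forall>w\<in>pverts G. \<forall>z\<in>pverts G. d u v = d w z \<longrightarrow>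
      (if u = v then sp (flip H u u) = sp (flip H w w)
       else sp (flip H u v) = sp (flip H w z) \<or>
         sp (amalgamate H u v) = sp (amalgamate H w z) \<or>
         sp (add_common_neighbour H u v) = sp (add_common_neighbour H w z)))"
    (is "_ \<longleftrightarrow> ?iso")
  proof
    assume iso: "D_isospectral D G"
    show ?iso
    proof (intro ballI impI)
      fix u v w z assume uv: "u \<in> pverts G" "v \<in> pverts G" and wz: "w \<in> pverts G" "z \<in> pverts G"
        and eq: "d u v = d w z"
      have iso': "punctually_isospectral (d u v) G" using iso D[OF uv] by (simp add: D_isospectral_def)
      show "if u = v then sp (flip H u u) = sp (flip H w w)
       else sp (flip H u v) = sp (flip H w z) \<or>
         sp (amalgamate H u v) = sp (amalgamate H w z) \<or>
         sp (add_common_neighbour H u v) = sp (add_common_neighbour H w z)"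
      \<comment> \<open>The definition distinguishes \<open>h = 0\<close>, the goal
        \<open>u = v\<close>; distance 0 identifies the two.\<close>
      proof (cases "u = v")
        case True
        then have "d u v = 0" using dist_self uv V by simp
        from iso'[unfolded punctually_isospectral_def if_P[OF this], folded H_def,
            rule_format, OF uv(1) wz(1)] True
        show ?thesis by simp
      next
        case False
        then have "d u v \<noteq> 0" using dist_eq_0_iff[of u v] uv V by simp
        from iso'[unfolded punctually_isospectral_def if_not_P[OF this], folded H_def d_def,
            rule_format, OF uv wz conjI[OF refl eq[symmetric]]] False
        show ?thesis by simp
      qed
    qed
  next
    assume iso: ?iso
    have "punctually_isospectral i G" for i
    proof (cases "i = 0")
      case True
      have "sp (flip H u u) = sp (flip H w w)" if "u \<in> pverts G" "w \<in> pverts G" for u w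
      proof -
        have "d u u = d w w" using that dist_self V by simp
        from iso[rule_format, OF that(1) that(1) that(2) that(2) this] show ?thesis by simp
      qed
      then show ?thesis
        unfolding punctually_isospectral_def H_def[symmetric] if_P[OF True] by blast
    next
      case False
      have "sp (flip H u v) = sp (flip H w z) \<or>
         sp (amalgamate H u v) = sp (amalgamate H w z) \<or>
         sp (add_common_neighbour H u v) = sp (add_common_neighbour H w z)"
        if "u \<in> pverts G" "v \<in> pverts G" "w \<in> pverts G" "z \<in> pverts G" "d u v = i" "d w z = i"
        for u v w z
      proof -
        have "u \<noteq> v" using that False dist_eq_0_iff[of u v] V by auto
        with iso[rule_format, OF that(1-4)] that(5,6) show ?thesis by simp
      qed
      then show ?thesis
        unfolding punctually_isospectral_def H_def[symmetric] d_def[symmetric] if_not_P[OF False]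
        by blast
    qed
    then show "D_isospectral D G" by (simp add: D_isospectral_def)
  qed
  \<comment> \<open>All three conditions are equivalent to the resolvent entries being determined by
    the distance.\<close>
  ultimately show ?thesis
    using intersection_numbers_iff_walks walks_determined_iff_resolvent
      cospectral_iff_resolvent isospectral_iff_resolvent
    unfolding V by argo
qed

end
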